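(* Let $\boldsymbol{\Phi}$ be an autonomous conformal iterated function system (ACIFS) in $\mathbb{R}^d$ satisfying the open set condition. Let $\mu$ be a Bernoulli measure on $\Sigma^\infty$ given by a positive probability vector. Suppose the image measure $\mu^\omega$ of $\mu$ satisfies the bounded overlap condition. Then for all $q>0$ with $q\ne1$, the generalized $q$-dimension $D_q(\mu^\omega)$ exists and $$D_q(\mu^\omega)=d_q.$$
   Context: Words. $I=\{1,\ldots,n\}$ with $n\ge2$. $\Sigma^k=I^k$ for $k\ge1$, $\Sigma^0=\{\emptyset\}$ (empty word), $\Sigma^*=\bigcup_{k\ge0}\Sigma^k$, $\Sigma^\infty=I^{\mathbb{N}}=\{u_1u_2\ldots:u_k\in I\}$. $\mathbf u|_m$ is the prefix of length $m$ of $\mathbf u$. $[\mathbf u]=\{\mathbf v\in\Sigma^\infty:\mathbf u\text{ is a prefix of }\mathbf v\}$. $\Sigma^\infty$ has the metric $d(\mathbf u,\mathbf v)=2^{-|\mathbf u\wedge\mathbf v|}$, with $|\mathbf u\wedge\mathbf v|$ the length of the longest common prefix. ACIFS. This is a non-autonomous conformal IFS $\boldsymbol\Phi=\{\Phi_k\}_{k\ge1}$ with $\Phi_k=\Phi_1=\{\varphi_i\}_{i\in I}$ for all $k$. Explicitly: $J\subset\mathbb{R}^d$ is compact with non-empty interior and $\overline{\mathrm{int}(J)}=J$; $\varphi_i:J\to J$; $\varphi_{\mathbf u}=\varphi_{u_1}\circ\cdots\circ\varphi_{u_k}$ for $\mathbf u=u_1\ldots u_k$ ($\varphi_\emptyset$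 the identity); and there are closed sets $J_{\mathbf u}\subset J$ ($\mathbf u\in\Sigma^*$, $J_\emptyset=J$) such that: (i) there is $0<c<1$ with $|\varphi_i(x)-\varphi_i(y)|\le c|x-y|$ for all $i\in I$, $x,y\in J$; (ii) $J_{\mathbf ui}\subset J_{\mathbf u}$ for all $\mathbf u\in\Sigma^*$, $i\in I$; (iii) for each $\mathbf u\in\Sigma^*$ there is $\omega_{\mathbf u}\in\mathbb{R}^d$ with $J_{\mathbf u}=\Psi_{\mathbf u}(J)=\varphi_{\mathbf u}(J)+\omega_{\mathbf u}$, where $\Psi_{\mathbf u}=\varphi_{\mathbf u}+\omega_{\mathbf u}$ (the translations $\omega_{\mathbf u}$ may depend arbitrarily on $\mathbf u$); (iv) there is an open connected set $V\supset J$ such that each $\varphi_i$ extends to a $C^1$ conformal diffeomorphism of $V$ into $V$; (v) there is $C\ge1$ with $\|D\varphi_{\mathbf u}(x)\|\le C\|D\varphi_{\mathbf u}(y)\|$ for all $\mathbf u\in\Sigma^*$, $x,y\in V$. $\|D\varphi_{\mathbf u}\|=\sup_{x\in J}\|D\varphi_{\mathbf u}(x)\|$. The attractor is $E=\bigcap_{k\ge1}\bigcup_{\mathbf u\in\Sigma^k}J_{\mathbf u}$. Open set condition: $\mathrm{int}(J_{\mathbf ui})\cap\mathrm{int}(J_{\mathbf uj})=\emptyset$ for all $\mathbf u\in\Sigma^*$ and $i\ne j\in I$. Bernoulli measure. For a positive probability vector $(p_1,\ldots,p_n)$ ($p_i>0$, $\sum_ip_i=1$), $\mu$ is the Borel probability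 measure on $\Sigma^\infty$ with $\mu([u_1\ldots u_k])=p_{u_1}\cdots p_{u_k}$. Image measure. $\pi(\mathbf u)=\bigcap_{m\ge1}J_{\mathbf u|_m}$ (a single point), $\mu^\omega(A)=\mu\{\mathbf u:\pi(\mathbf u)\in A\}$. Bounded overlap condition: there is $C\ge1$ with $C^{-1}\mu^\omega(J_{\mathbf u})\le\mu([\mathbf u])\le C\mu^\omega(J_{\mathbf u})$ for all $\mathbf u\in\Sigma^*$. Generalized $q$-dimension ($q\ne1$). For a positive finite Borel measure $\nu$ on $\mathbb{R}^d$ and $\mathcal M_\delta$ the family of $\delta$-mesh cubes $\prod_{j=1}^d[m_j\delta,(m_j+1)\delta)$, $m_j\in\mathbb{Z}$, $\underline D_q(\nu)$ and $\overline D_q(\nu)$ are the $\liminf$ and $\limsup$ as $\delta\to0$ of $\frac{\log\sum_{Q\in\mathcal M_\delta}\nu(Q)^q}{(q-1)\log\delta}$; $D_q(\nu)$ is the common value when they agree. Pressure. For $t\in\mathbb{R}$, $q>0$, $q\ne1$, $P^\mu(t,q)=\lim_{k\to\infty}\frac{\mathrm{sgn}(1-q)}{k}\log\sum_{\mathbf u\in\Sigma^k}\|D\varphi_{\mathbf u}\|^{t(1-q)}\mu([\mathbf u])^q$; in the present setting this limit exists, and $d_q=\inf\{t:P^\mu(t,q)<0\}=\sup\{t:P^\mu(t,q)>0\}$. *)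

theory Defs
  imports "HOL-Analysis.Analysis" "HOL-Probability.Probability_Measure"
begin

section \<open>Symbolic space\<close>

text \<open>The alphabet is a finite type \<open>'i\<close>; finite words are lists, infinite words are functions
  \<open>nat \<Rightarrow> 'i\<close>, whose \<open>k\<close>-th letter is the value at \<open>k - 1\<close>.\<close>

definition prefix_word :: "nat \<Rightarrow> (nat \<Rightarrow> 'i) \<Rightarrow> 'i list" where
  "prefix_word m u = map u [0..<m]"

definition cylinder :: "'i list \<Rightarrow> (nat \<Rightarrow> 'i) set" where
  "cylinder u = {v. prefix_word (length u) v = u}"

text \<open>For distinct words the least index of disagreement is the length of the longest common
  prefix.\<close>

definition word_dist :: "(nat \<Rightarrow> 'i) \<Rightarrow> (nat \<Rightarrow> 'i) \<Rightarrow> real" where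
  "word_dist u v = (if u = v then 0 else (1/2) ^ (LEAST k. u k \<noteq> v k))"

lemma Metric_space_word_dist: "Metric_space UNIV word_dist"
proof
  fix u v w :: "nat \<Rightarrow> 'i"
  show "0 \<le> word_dist u v" by (simp add: word_dist_def)
  show "word_dist u v = word_dist v u" by (simp add: word_dist_def eq_commute)
  show "word_dist u v = 0 \<longleftrightarrow> u = v" by (simp add: word_dist_def)
  show "word_dist u w \<le> word_dist u v + word_dist v w"
  proof (cases "u = v \<or> v = w \<or> u = w")
    case True
    then show ?thesis by (auto simp: word_dist_def)
  next
    case False
    define a b c where "a = (LEAST k. u k \<noteq> v k)" and "b = (LEAST k. v k \<noteq> w k)"
      and "c = (LEAST k. u k \<noteq> w k)"
    have "u c \<noteq> w c"
      unfolding c_def by (rule LeastI_ex) (use False in auto)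
    then have "u c \<noteq> v c \<or> v c \<noteq> w c" by auto
    then have "a \<le> c \<or> b \<le> c"
      unfolding a_def b_def by (auto intro: Least_le)
    then have "(1/2::real) ^ c \<le> (1/2) ^ a \<or> (1/2::real) ^ c \<le> (1/2) ^ b"
      by (auto intro: power_decreasing)
    moreover have "0 \<le> (1/2::real) ^ a" "0 \<le> (1/2::real) ^ b" by auto
    ultimately have "(1/2::real) ^ c \<le> (1/2) ^ a + (1/2) ^ b" by linarith
    then show ?thesis using False by (simp add: word_dist_def a_def b_def c_def)
  qed
qed

definition word_borel :: "(nat \<Rightarrow> 'i) measure" where
  "word_borel = sigma UNIV {U. openin (Metric_space.mtopology UNIV word_dist) U}"

definition bernoulli_measure :: "('i \<Rightarrow> real) \<Rightarrow> (nat \<Rightarrow> 'i) measure \<Rightarrow> bool" where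
  "bernoulli_measure p \<mu> \<longleftrightarrow>
     prob_space \<mu> \<and> sets \<mu> = sets word_borel \<and>
     (\<forall>u. measure \<mu> (cylinder u) = (\<Prod>i\<leftarrow>u. p i))"


section \<open>Autonomous conformal iterated function systems\<close>

definition C1_on :: "'a::real_normed_vector set \<Rightarrow> ('a \<Rightarrow> 'b::real_normed_vector) \<Rightarrow> bool" where
  "C1_on S f \<longleftrightarrow>
     (\<exists>f'. (\<forall>x\<in>S. (f has_derivative blinfun_apply (f' x)) (at x)) \<and> continuous_on S f')"

definition conformal_diffeo_into ::
    "'a::euclidean_space set \<Rightarrow> ('a \<Rightarrow> 'a) \<Rightarrow> bool" where
  "conformal_diffeo_into V f \<longleftrightarrow>
     f ` V \<subseteq> V \<and> inj_on f V \<and> open (f ` V) \<and>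
     C1_on V f \<and> C1_on (f ` V) (inv_into V f) \<and>
     (\<forall>x\<in>V. \<exists>r A. r > 0 \<and> orthogonal_transformation A \<and>
        frechet_derivative f (at x) = (\<lambda>h. r *\<^sub>R A h))"

primrec word_map :: "('i \<Rightarrow> 'a \<Rightarrow> 'a) \<Rightarrow> 'i list \<Rightarrow> 'a \<Rightarrow> 'a" where
  "word_map \<phi> [] = id"
| "word_map \<phi> (i # u) = \<phi> i \<circ> word_map \<phi> u"

definition deriv_norm_at ::
    "('i \<Rightarrow> 'a::euclidean_space \<Rightarrow> 'a) \<Rightarrow> 'i list \<Rightarrow> 'a \<Rightarrow> real" where
  "deriv_norm_at \<phi> u x = onorm (frechet_derivative (word_map \<phi> u) (at x))"

definition deriv_norm ::
    "'a::euclidean_space set \<Rightarrow> ('i \<Rightarrow> 'a \<Rightarrow> 'a) \<Rightarrow> 'i list \<Rightarrow> real" where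
  "deriv_norm J \<phi> u = (SUP x\<in>J. deriv_norm_at \<phi> u x)"

text \<open>The map \<open>\<phi> i\<close> is total; on \<open>V\<close> it stands for the conformal extension and on \<open>J\<close> for the
  contraction itself, while its values outside \<open>V\<close> are irrelevant. The set \<open>Js u\<close> is
  the piece \<open>J\<^sub>u\<close>.\<close>

locale acifs =
  fixes J V :: "(real^'d) set"
    and \<phi> :: "'i::finite \<Rightarrow> real^'d \<Rightarrow> real^'d"
    and Js :: "'i list \<Rightarrow> (real^'d) set"
  assumes card_alphabet: "CARD('i) \<ge> 2"
    and J_compact: "compact J"
    and J_interior: "interior J \<noteq> {}"
    and J_regular: "closure (interior J) = J"
    and \<phi>_into: "\<And>i. \<phi> i ` J \<subseteq> J"
    and Js_closed: "\<And>u. closed (Js u)"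
    and Js_subset: "\<And>u. Js u \<subseteq> J"
    and Js_Nil: "Js [] = J"
    and contraction:
      "\<exists>c. 0 < c \<and> c < 1 \<and> (\<forall>i. \<forall>x\<in>J. \<forall>y\<in>J. norm (\<phi> i x - \<phi> i y) \<le> c * norm (x - y))"
    and Js_nested: "\<And>u i. Js (u @ [i]) \<subseteq> Js u"
    and Js_translate: "\<And>u. \<exists>\<omega>. Js u = (\<lambda>x. word_map \<phi> u x + \<omega>) ` J"
    and V_open: "open V"
    and V_connected: "connected V"
    and J_subset_V: "J \<subseteq> V"
    and conformal: "\<And>i. conformal_diffeo_into V (\<phi> i)"
    and bounded_distortion:
      "\<exists>C\<ge>1. \<forall>u. \<forall>x\<in>V. \<forall>y\<in>V. deriv_norm_at \<phi> u x \<le> C * deriv_norm_at \<phi> u y"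

definition open_set_condition :: "('i list \<Rightarrow> 'a::topological_space set) \<Rightarrow> bool" where
  "open_set_condition Js \<longleftrightarrow>
     (\<forall>u i j. i \<noteq> j \<longrightarrow> interior (Js (u @ [i])) \<inter> interior (Js (u @ [j])) = {})"


section \<open>Image measure, generalized dimensions and pressure\<close>

definition coding :: "('i list \<Rightarrow> 'a set) \<Rightarrow> (nat \<Rightarrow> 'i) \<Rightarrow> 'a" where
  "coding Js u = the_elem (\<Inter>m\<in>{1..}. Js (prefix_word m u))"

definition image_measure ::
    "('i list \<Rightarrow> 'a::topological_space set) \<Rightarrow> (nat \<Rightarrow> 'i) measure \<Rightarrow> 'a measure" where
  "image_measure Js \<mu> = distr \<mu> borel (coding Js)"

definition bounded_overlap ::
    "('i list \<Rightarrow> 'a::topological_space set) \<Rightarrow> (nat \<Rightarrow> 'i) measure \<Rightarrow> bool" where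
  "bounded_overlap Js \<mu> \<longleftrightarrow>
     (\<exists>C\<ge>1. \<forall>u. inverse C * measure (image_measure Js \<mu>) (Js u) \<le> measure \<mu> (cylinder u) \<and>
                 measure \<mu> (cylinder u) \<le> C * measure (image_measure Js \<mu>) (Js u))"

definition mesh_cubes :: "real \<Rightarrow> (real^'d) set set" where
  "mesh_cubes \<delta> =
     range (\<lambda>m :: int^'d. {x. \<forall>j. of_int (m $ j) * \<delta> \<le> x $ j \<and> x $ j < (of_int (m $ j) + 1) * \<delta>})"

text \<open>The moment sum may be infinite for \<open>q < 1\<close> and a measure of unbounded support, so it is taken
  in the extended reals. Cubes of measure zero contribute nothing, as \<open>0 powr q = 0\<close>.\<close>

definition moment_sum :: "real \<Rightarrow> (real^'d) measure \<Rightarrow> real \<Rightarrow> ennreal" where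
  "moment_sum q \<nu> \<delta> = (\<Sum>\<^sub>\<infinity>Q\<in>mesh_cubes \<delta>. ennreal (measure \<nu> Q powr q))"

definition ln_ext :: "ennreal \<Rightarrow> ereal" where
  "ln_ext x = (if x = 0 then -\<infinity> else if x = top then \<infinity> else ereal (ln (enn2real x)))"

definition lower_gen_dim :: "real \<Rightarrow> (real^'d) measure \<Rightarrow> ereal" where
  "lower_gen_dim q \<nu> =
     Liminf (at_right 0) (\<lambda>\<delta>. ln_ext (moment_sum q \<nu> \<delta>) / ereal ((q - 1) * ln \<delta>))"

definition upper_gen_dim :: "real \<Rightarrow> (real^'d) measure \<Rightarrow> ereal" where
  "upper_gen_dim q \<nu> =
     Limsup (at_right 0) (\<lambda>\<delta>. ln_ext (moment_sum q \<nu> \<delta>) / ereal ((q - 1) * ln \<delta>))"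

definition has_gen_dim :: "real \<Rightarrow> (real^'d) measure \<Rightarrow> ereal \<Rightarrow> bool" where
  "has_gen_dim q \<nu> D \<longleftrightarrow> lower_gen_dim q \<nu> = D \<and> upper_gen_dim q \<nu> = D"

definition pressure ::
    "'a::euclidean_space set \<Rightarrow> ('i \<Rightarrow> 'a \<Rightarrow> 'a) \<Rightarrow> (nat \<Rightarrow> 'i) measure \<Rightarrow> real \<Rightarrow> real \<Rightarrow> real" where
  "pressure J \<phi> \<mu> t q =
     lim (\<lambda>k. sgn (1 - q) / real k *
       ln (\<Sum>u | length u = k. deriv_norm J \<phi> u powr (t * (1 - q)) * measure \<mu> (cylinder u) powr q))"

text \<open>In the setting of Bernoulli measures on an ACIFS the limit above exists and the infimum below
  coincides with \<open>Sup {t. pressure J \<phi> \<mu> t q > 0}\<close>.\<close>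

definition pressure_dim ::
    "'a::euclidean_space set \<Rightarrow> ('i \<Rightarrow> 'a \<Rightarrow> 'a) \<Rightarrow> (nat \<Rightarrow> 'i) measure \<Rightarrow> real \<Rightarrow> real" where
  "pressure_dim J \<phi> \<mu> q = Inf {t. pressure J \<phi> \<mu> t q < 0}"

end

theory Submission
  imports Defs "HOL-Library.Sublist"
begin

text \<open>
  Write \<open>a u\<close> for the derivative norm of the word \<open>u\<close>. Bounded distortion makes \<open>a\<close>, hence also every weight
  \<open>w u = a u powr \<beta> * \<mu> [u] powr q\<close>, multiplicative under concatenation up to a constant. So the sum of \<open>w\<close>
  over the words of length \<open>k\<close> is within a constant factor of \<open>exp (k G)\<close>, where \<open>G = G(\<beta>)\<close> is continuous
  and strictly decreasing, with zero \<open>\<beta> = (1 - q) d\<^sub>q\<close>. At this zero the sum of \<open>w\<close> over any finite complete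
  prefix code is bounded above and below. Applied to the words at which \<open>a\<close> first drops to \<open>\<delta>\<close>, this says that
  the sum of \<open>\<mu> [u] powr q\<close> over them is comparable to \<open>\<delta> powr ((q - 1) d\<^sub>q)\<close>.

  The piece of such a word has diameter \<open>O(\<delta>)\<close> and contains a ball of radius comparable to \<open>\<delta>\<close>. By the
  open set condition and volume comparison each mesh cube of side \<open>\<delta>\<close> meets boundedly many of these pieces, and
  each piece meets boundedly many cubes, so the moment sum at scale \<open>\<delta>\<close> is comparable to the sum above.
\<close>

text \<open>The translations of the pieces may change from word to word, so the pieces need not be
  images of each other under the maps, and self-similarity of the attractor cannot be used. The
  estimates therefore rest on what a translation leaves unchanged: the derivative norms, the
  diameter of a piece and the radius of a ball inside it. Positions enter only through inclusions
  between pieces and through the open set condition. Sums are bounded by constants, and not merely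
  up to subexponential factors, because distortion makes ln of the level sums additive up to a
  bounded error; at the zero of \<open>G\<close> the level sums themselves stay between two
  constants. The exponent \<beta> = t (1 - q) replaces t so that \<open>G\<close> decreases for
  every q; the sign of 1 - q matters only in the translation back to pressure. Passing between cubes
  and pieces compares a sum of boundedly many terms with its largest term, which treats q < 1 and q
  > 1 alike.\<close>

section \<open>Quasi-multiplicative weights on words\<close>

text \<open>The limit exists because \<open>x (k * l)\<close> is close to both \<open>k * x l\<close> and \<open>l * x k\<close>.\<close>

lemma quasi_additive_rate:
  fixes x :: "nat \<Rightarrow> real"
  assumes "\<And>k l. \<bar>x (k + l) - x k - x l\<bar> \<le> M"
  obtains P where "(\<lambda>k. x k / real k) \<longlonglongrightarrow> P" "\<And>k. \<bar>x k - real k * P\<bar> \<le> M"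
proof -
  have M0: "M \<ge> 0" using assms[of 0 0] by linarith
  have mult': "\<bar>x (k * l) - real k * x l\<bar> \<le> real k * M" if "k > 0" for k l
    using that
  proof (induction k rule: nat_induct_non_zero)
    case 1
    show ?case using M0 by simp
  next
    case (Suc k)
    have "x (Suc k * l) - real (Suc k) * x l =
        (x (k * l) - real k * x l) + (x (l + k * l) - x l - x (k * l))"
      by (simp add: algebra_simps)
    moreover have "real (Suc k) * M = real k * M + M" by (simp add: algebra_simps)
    ultimately show ?case using Suc.IH assms[of l "k * l"] by linarith
  qed
  have scaled: "\<bar>x (k * l) / (real k * real l) - x l / real l\<bar> \<le> M / real l" if "k > 0" "l > 0" for k l
  proof -
    have "x (k * l) / (real k * real l) - x l / real l = (x (k * l) - real k * x l) / (real k * real l)"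
      using that by (simp add: field_simps)
    then have "\<bar>x (k * l) / (real k * real l) - x l / real l\<bar> = \<bar>x (k * l) - real k * x l\<bar> / (real k * real l)"
      by simp
    also have "\<dots> \<le> (real k * M) / (real k * real l)"
      by (intro divide_right_mono mult') (use that in auto)
    finally show ?thesis using that by simp
  qed
  have diff: "\<bar>x k / real k - x l / real l\<bar> \<le> M / real k + M / real l" if "k > 0" "l > 0" for k l
  proof -
    have "\<bar>x (k * l) / (real k * real l) - x k / real k\<bar> \<le> M / real k"
      using scaled[OF that(2) that(1)] by (simp add: mult.commute)
    with scaled[OF that] show ?thesis by linarith
  qed
  have lim0: "(\<lambda>k. M / real k) \<longlonglongrightarrow> 0"
    by (rule lim_const_over_n)
  have "Cauchy (\<lambda>k. x k / real k)"
  proof (rule metric_CauchyI)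
    fix e :: real assume "e > 0"
    then have "\<forall>\<^sub>F k in sequentially. M / real k < e / 2"
      using order_tendstoD(2)[OF lim0, of "e/2"] by simp
    then obtain N where N: "\<And>k. k \<ge> N \<Longrightarrow> M / real k < e / 2"
      by (auto simp: eventually_sequentially)
    show "\<exists>N. \<forall>m\<ge>N. \<forall>n\<ge>N. dist (x m / real m) (x n / real n) < e"
    proof (intro exI allI impI)
      fix m n assume "m \<ge> max N 1" "n \<ge> max N 1"
      then have mn: "m \<ge> N" "m > 0" "n \<ge> N" "n > 0" by auto
      show "dist (x m / real m) (x n / real n) < e"
        using diff[OF mn(2,4)] N[OF mn(1)] N[OF mn(3)] unfolding dist_real_def by linarith
    qed
  qed
  then obtain P where P: "(\<lambda>k. x k / real k) \<longlonglongrightarrow> P"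
    using Cauchy_convergent convergent_def by blast
  have "\<bar>x k - real k * P\<bar> \<le> M" for k
  proof (cases "k = 0")
    case True
    then show ?thesis using assms[of 0 0] by simp
  next
    case False
    \<comment> \<open>Letting \<open>l\<close> tend to infinity in \<open>diff\<close> at fixed
      \<open>k\<close> leaves the error \<open>M / k\<close>, so the deviation from
      \<open>k * P\<close> is at most \<open>M\<close>, uniformly in \<open>k\<close>.\<close>
    have "(\<lambda>l. \<bar>x k / real k - x l / real l\<bar>) \<longlonglongrightarrow> \<bar>x k / real k - P\<bar>"
      by (intro tendsto_intros P)
    moreover have "(\<lambda>l. M / real k + M / real l) \<longlonglongrightarrow> M / real k + 0"
      by (intro tendsto_intros lim0)
    moreover have "\<forall>\<^sub>F l in sequentially. \<bar>x k / real k - x l / real l\<bar> \<le> M / real k + M / real l"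
      using eventually_gt_at_top[of 0] by eventually_elim (use diff False in auto)
    ultimately have "\<bar>x k / real k - P\<bar> \<le> M / real k + 0"
      by (intro tendsto_le[OF trivial_limit_sequentially]) auto
    then have "real k * \<bar>x k / real k - P\<bar> \<le> real k * (M / real k)"
      by (intro mult_left_mono) auto
    moreover have "real k * \<bar>x k / real k - P\<bar> = \<bar>real k * (x k / real k - P)\<bar>"
      by (simp add: abs_mult)
    moreover have "real k * (x k / real k - P) = x k - real k * P" "real k * (M / real k) = M"
      using False by (simp_all add: field_simps)
    ultimately show ?thesis by simp
  qed
  with P that show ?thesis by blast
qed

text \<open>The assumptions say \<bar>ln x\<bar> \<le> ln C, and scaling by \<beta> gives an
  interval that is symmetric about 0. Hence the absolute value in the exponent: t (1 - q) can have
  either sign.\<close>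

lemma powr_abs_bounds:
  fixes x C \<beta> :: real
  assumes "inverse C \<le> x" "x \<le> C" "C \<ge> 1"
  shows "inverse (C powr \<bar>\<beta>\<bar>) \<le> x powr \<beta>" "x powr \<beta> \<le> C powr \<bar>\<beta>\<bar>"
proof -
  have x: "x > 0" using assms by (metis less_le_trans positive_imp_inverse_positive zero_less_one)
  have "ln (inverse C) \<le> ln x" "ln x \<le> ln C"
    using assms x by (auto intro: ln_mono)
  then have "\<bar>ln x\<bar> \<le> ln C" using assms by (simp add: ln_inverse)
  then have "\<bar>\<beta> * ln x\<bar> \<le> \<bar>\<beta>\<bar> * ln C" by (simp add: abs_mult mult_left_mono)
  then have "\<beta> * ln x \<le> \<bar>\<beta>\<bar> * ln C" "- (\<bar>\<beta>\<bar> * ln C) \<le> \<beta> * ln x" by auto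
  then show "inverse (C powr \<bar>\<beta>\<bar>) \<le> x powr \<beta>" "x powr \<beta> \<le> C powr \<bar>\<beta>\<bar>"
    using x assms by (auto simp: powr_def simp flip: exp_minus)
qed

section \<open>Words of fixed length and complete finite prefix codes\<close>

abbreviation words :: "nat \<Rightarrow> 'i list set" where
  "words k \<equiv> {u. length u = k}"

lemma finite_words: "finite (words k :: 'i::finite list set)"
  using finite_lists_length_eq[of "UNIV :: 'i set" k] by simp

lemma words_ne: "words k \<noteq> {}"
proof -
  have "replicate k undefined \<in> words k" by simp
  then show ?thesis by blast
qed

lemma sum_words_append:
  fixes f :: "'i::finite list \<Rightarrow> real"
  shows "(\<Sum>u\<in>words (k + l). f u) = (\<Sum>u\<in>words k. \<Sum>v\<in>words l. f (u @ v))"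
proof -
  have "bij_betw (\<lambda>(u, v). u @ v) (words k \<times> words l) (words (k + l) :: 'i list set)"
    by (rule bij_betw_byWitness[where f' = "\<lambda>u. (take k u, drop k u)"]) auto
  then have "(\<Sum>u\<in>words (k + l). f u) = (\<Sum>(u, v)\<in>words k \<times> words l. f (u @ v))"
    by (subst sum.reindex_bij_betw[symmetric]) (auto simp: case_prod_unfold)
  then show ?thesis
    by (simp add: sum.cartesian_product)
qed

text \<open>A finite maximal antichain of the prefix order. Completeness is asked of long finite
  words only, since short words may be proper prefixes of code words.\<close>

definition cut_set :: "'i list set \<Rightarrow> bool" where
  "cut_set S \<longleftrightarrow> finite S \<and> (\<forall>u v. u \<in> S \<longrightarrow> u @ v \<in> S \<longrightarrow> v = []) \<and>
     (\<exists>N. \<forall>u. length u \<ge> N \<longrightarrow> (\<exists>v\<in>S. \<exists>z. u = v @ z))"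

lemma cut_set_cong_prefix:
  assumes "cut_set S" "u \<in> S" "u' \<in> S" "u @ v = u' @ v'"
  shows "u = u'" "v = v'"
proof -
  obtain z where "u = u' @ z \<or> u' = u @ z"
    using assms(4) by (auto simp: append_eq_append_conv2)
  then show "u = u'" using assms by (auto simp: cut_set_def)
  then show "v = v'" using assms(4) by simp
qed

text \<open>A word that is long enough splits in exactly one way into a code word and a remainder:
  existence is completeness, uniqueness is prefix-freeness. This links a sum over the code to a sum
  over one level.\<close>

lemma sum_words_cut_set:
  fixes S :: "'i::finite list set" and f :: "'i::finite list \<Rightarrow> real"
  assumes "cut_set S"
  obtains k where "\<And>v. v \<in> S \<Longrightarrow> length v \<le> k"
    "(\<Sum>u\<in>words k. f u) = (\<Sum>v\<in>S. \<Sum>z\<in>words (k - length v). f (v @ z))"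
proof -
  obtain N where N: "\<And>u. length u \<ge> N \<Longrightarrow> \<exists>v\<in>S. \<exists>z. u = v @ z" and fin: "finite S"
    using assms unfolding cut_set_def by auto
  \<comment> \<open>The level must lie beyond \<open>N\<close>, for completeness, and beyond every
    code word, so that the length of the remainder is not cut off by subtraction on
    naturals.\<close>
  define k where "k = Max (insert N (length ` S))"
  have le: "length v \<le> k" if "v \<in> S" for v using that fin by (auto simp: k_def)
  have kN: "k \<ge> N" using fin by (auto simp: k_def)
  have "bij_betw (\<lambda>(u, v). u @ v) (SIGMA v:S. words (k - length v)) (words k)"
  proof (rule bij_betw_imageI)
    show "inj_on (\<lambda>(u, v). u @ v) (SIGMA v:S. words (k - length v))"
      unfolding inj_on_def
    proof (clarify)
      fix u v u' v' assume "u \<in> S" "u' \<in> S" "u @ v = u' @ v'"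
      then show "u = u' \<and> v = v'" using cut_set_cong_prefix[OF assms] by blast
    qed
    show "(\<lambda>(u, v). u @ v) ` (SIGMA v:S. words (k - length v)) = words k"
    proof (intro equalityI subsetI)
      fix u :: "'i list" assume "u \<in> words k"
      then obtain v z where "v \<in> S" "u = v @ z" using N[of u] kN by auto
      then show "u \<in> (\<lambda>(u, v). u @ v) ` (SIGMA v:S. words (k - length v))"
        using \<open>u \<in> words k\<close> by (intro image_eqI[of _ _ "(v, z)"]) auto
    qed (use le in auto)
  qed
  then have "(\<Sum>u\<in>words k. f u) = (\<Sum>(u, v)\<in>(SIGMA v:S. words (k - length v)). f (u @ v))"
    by (subst sum.reindex_bij_betw[symmetric]) (auto simp: case_prod_unfold)
  also have "\<dots> = (\<Sum>v\<in>S. \<Sum>z\<in>words (k - length v). f (v @ z))"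
    using fin by (subst sum.Sigma) (auto simp: finite_words)
  finally show ?thesis using that le by blast
qed

section \<open>Level sums and code sums of a quasi-multiplicative weight\<close>

locale quasi_mult_weight =
  fixes w :: "'i::finite list \<Rightarrow> real" and K :: real
  assumes w_pos: "w u > 0"
    and K_ge_1: "K \<ge> 1"
    and w_append_le: "w (u @ v) \<le> K * (w u * w v)"
    and w_append_ge: "w u * w v \<le> K * w (u @ v)"
begin

definition total :: "nat \<Rightarrow> real" where
  "total k = (\<Sum>u\<in>words k. w u)"

lemma total_pos: "total k > 0"
  unfolding total_def by (intro sum_pos finite_words words_ne w_pos)

lemma total_add:
  "total (k + l) \<le> K * (total k * total l)" "total k * total l \<le> K * total (k + l)"
proof -
  have eq: "total k * total l = (\<Sum>u\<in>words k. \<Sum>v\<in>words l. w u * w v)"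
    unfolding total_def by (rule sum_product)
  show "total (k + l) \<le> K * (total k * total l)"
    unfolding eq unfolding total_def sum_words_append sum_distrib_left
    by (intro sum_mono w_append_le)
  show "total k * total l \<le> K * total (k + l)"
    unfolding eq unfolding total_def sum_words_append sum_distrib_left
    by (intro sum_mono w_append_ge)
qed

lemma ln_total_quasi_additive: "\<bar>ln (total (k + l)) - ln (total k) - ln (total l)\<bar> \<le> ln K"
proof -
  have "ln (total (k + l)) \<le> ln (K * (total k * total l))"
    using total_add(1) total_pos by (intro ln_mono) auto
  moreover have "ln (total k * total l) \<le> ln (K * total (k + l))"
    using total_add(2) total_pos by (intro ln_mono) auto
  ultimately show ?thesis
    using K_ge_1 total_pos[of k] total_pos[of l] total_pos[of "k + l"]
    by (simp add: ln_mult)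
qed

definition rate :: real where
  "rate = lim (\<lambda>k. ln (total k) / real k)"

lemma rate_tendsto: "(\<lambda>k. ln (total k) / real k) \<longlonglongrightarrow> rate"
  and rate_bound: "\<bar>ln (total k) - real k * rate\<bar> \<le> ln K"
proof -
  obtain P where P: "(\<lambda>k. ln (total k) / real k) \<longlonglongrightarrow> P" "\<And>k. \<bar>ln (total k) - real k * P\<bar> \<le> ln K"
    using quasi_additive_rate[of "\<lambda>k. ln (total k)", OF ln_total_quasi_additive] by blast
  moreover have "P = rate" unfolding rate_def using P(1) by (simp add: limI)
  ultimately show "(\<lambda>k. ln (total k) / real k) \<longlonglongrightarrow> rate" "\<bar>ln (total k) - real k * rate\<bar> \<le> ln K"
    by auto
qed

lemma total_bounds_rate_0:
  assumes "rate = 0"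
  shows "inverse K \<le> total k" "total k \<le> K"
proof -
  have "ln (total k) \<le> ln K" "ln (inverse K) \<le> ln (total k)"
    using rate_bound[of k] assms K_ge_1 by (auto simp: ln_inverse)
  then show "inverse K \<le> total k" "total k \<le> K"
    using K_ge_1 total_pos[of k] by auto
qed

text \<open>At rate 0 every level sum lies between 1 / K and K. Grouping a deep level by code words,
  each group has sum \<open>w v\<close> up to one factor \<open>K\<close> for splitting the word and
  one for the level sum of the remainders; the deep level itself contributes the third
  factor.\<close>

lemma cut_set_bounds:
  assumes "rate = 0" "cut_set S"
  shows "inverse (K ^ 3) \<le> (\<Sum>v\<in>S. w v)" "(\<Sum>v\<in>S. w v) \<le> K ^ 3"
proof -
  obtain k where k: "\<And>v. v \<in> S \<Longrightarrow> length v \<le> k"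
    "total k = (\<Sum>v\<in>S. \<Sum>z\<in>words (k - length v). w (v @ z))"
    using sum_words_cut_set[OF assms(2), of w] unfolding total_def by blast
  have K0: "K > 0" using K_ge_1 by simp
  have le: "(\<Sum>z\<in>words (k - length v). w (v @ z)) \<le> K * K * w v" for v
  proof -
    have "(\<Sum>z\<in>words (k - length v). w (v @ z)) \<le> (\<Sum>z\<in>words (k - length v). K * (w v * w z))"
      by (intro sum_mono w_append_le)
    also have "\<dots> = K * w v * total (k - length v)"
      by (simp add: total_def sum_distrib_left mult.assoc)
    also have "\<dots> \<le> K * w v * K"
      using total_bounds_rate_0[OF assms(1)] K0 w_pos[of v] by (intro mult_left_mono) auto
    finally show ?thesis by (simp add: ac_simps)
  qed
  have ge: "w v \<le> K * K * (\<Sum>z\<in>words (k - length v). w (v @ z))" for v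
  proof -
    have "w v = K * (w v * inverse K)" using K0 by simp
    also have "\<dots> \<le> K * (w v * total (k - length v))"
      using total_bounds_rate_0[OF assms(1)] K0 w_pos[of v] by (intro mult_left_mono) auto
    also have "w v * total (k - length v) = (\<Sum>z\<in>words (k - length v). w v * w z)"
      by (simp add: total_def sum_distrib_left)
    also have "K * \<dots> \<le> K * (\<Sum>z\<in>words (k - length v). K * w (v @ z))"
      using K0 by (intro mult_left_mono sum_mono w_append_ge) auto
    finally show ?thesis by (simp add: sum_distrib_left mult.assoc)
  qed
  have "inverse K \<le> total k" by (rule total_bounds_rate_0[OF assms(1)])
  also have "total k \<le> (\<Sum>v\<in>S. K * K * w v)" unfolding k(2) by (intro sum_mono le)
  also have "\<dots> = K * K * (\<Sum>v\<in>S. w v)" by (simp add: sum_distrib_left)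
  finally show "inverse (K ^ 3) \<le> (\<Sum>v\<in>S. w v)"
    using K0 by (simp add: field_simps power3_eq_cube)
  have "(\<Sum>v\<in>S. w v) \<le> (\<Sum>v\<in>S. K * K * (\<Sum>z\<in>words (k - length v). w (v @ z)))"
    by (intro sum_mono ge)
  also have "\<dots> = K * K * total k" by (simp add: k(2) sum_distrib_left)
  also have "\<dots> \<le> K * K * K"
    using total_bounds_rate_0[OF assms(1)] K0 by (intro mult_left_mono) auto
  finally show "(\<Sum>v\<in>S. w v) \<le> K ^ 3" by (simp add: power3_eq_cube)
qed

end

section \<open>Balls in Euclidean space\<close>

lemma bounded_ball_fmeasurable: "ball (x :: 'a::euclidean_space) r \<in> fmeasurable lborel"
  using emeasure_bounded_finite[of "ball x r"] by (simp add: fmeasurable_def)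

text \<open>Volume comparison: all the balls lie in the ball of radius R + s about
  \<open>z\<close>.\<close>

lemma card_disjoint_balls_le:
  fixes c :: "'b \<Rightarrow> 'a::euclidean_space"
  assumes "finite I" "s > 0" "R \<ge> 0"
    and centres: "\<And>i. i \<in> I \<Longrightarrow> dist z (c i) \<le> R"
    and disj: "\<And>i j. i \<in> I \<Longrightarrow> j \<in> I \<Longrightarrow> i \<noteq> j \<Longrightarrow> ball (c i) s \<inter> ball (c j) s = {}"
  shows "real (card I) \<le> ((R + s) / s) ^ DIM('a)"
proof -
  define \<kappa> where "\<kappa> = unit_ball_vol (real DIM('a))"
  have \<kappa>: "\<kappa> > 0" unfolding \<kappa>_def by simp
  have "(\<Sum>i\<in>I. measure lborel (ball (c i) s)) = measure lborel (\<Union>i\<in>I. ball (c i) s)"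
    using assms(1) disj
    by (intro measure_UNION'[symmetric]) (auto simp: pairwise_def disjnt_def intro: bounded_ball_fmeasurable)
  also have "\<dots> \<le> measure lborel (ball z (R + s))"
  proof (rule measure_mono_fmeasurable)
    show "(\<Union>i\<in>I. ball (c i) s) \<subseteq> ball z (R + s)"
    proof clarify
      fix i x assume "i \<in> I" "x \<in> ball (c i) s"
      then show "x \<in> ball z (R + s)"
        using centres[of i] dist_triangle[of z x "c i"] by simp
    qed
  qed (use assms(1) in \<open>auto intro: bounded_ball_fmeasurable borel_open\<close>)
  finally have "real (card I) * (\<kappa> * s ^ DIM('a)) \<le> \<kappa> * (R + s) ^ DIM('a)"
    using assms by (simp add: content_ball \<kappa>_def)
  then show ?thesis
    using \<kappa> assms(2) by (simp add: power_divide field_simps)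
qed

text \<open>The inverse is Lipschitz with constant \<open>1 / m\<close> on the largest ball around \<open>f a\<close> inside the image; if its
  radius were below \<open>m * \<rho>\<close>, its closure would stay in the image as well.\<close>

lemma ball_subset_image_ball:
  fixes f :: "'a::euclidean_space \<Rightarrow> 'a"
  assumes "\<rho> > 0" "m > 0" and inj: "inj_on f (ball a \<rho>)"
    and deriv: "\<And>x. x \<in> ball a \<rho> \<Longrightarrow> \<exists>D. (f has_derivative D) (at x) \<and> (\<forall>h. m * norm h \<le> norm (D h))"
  shows "ball (f a) (m * \<rho>) \<subseteq> f ` ball a \<rho>"
proof -
  let ?W = "f ` ball a \<rho>"
  define g where "g = inv_into (ball a \<rho>) f"
  have gf: "g (f x) = x" if "x \<in> ball a \<rho>" for x
    using inj that by (simp add: g_def)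
  have contf: "continuous_on (ball a \<rho>) f"
    using deriv by (meson continuous_at_imp_continuous_on has_derivative_continuous)
  have openW: "open ?W"
    by (intro invariance_of_domain contf inj) auto
  have aW: "f a \<in> ?W" using assms(1) by auto
  have derg: "\<exists>D'. (g has_derivative D') (at y) \<and> onorm D' \<le> inverse m" if "y \<in> ?W" for y
  proof -
    obtain x where x: "x \<in> ball a \<rho>" "y = f x" using \<open>y \<in> ?W\<close> by auto
    obtain D where D: "(f has_derivative D) (at x)" "\<And>h. m * norm h \<le> norm (D h)"
      using deriv[OF x(1)] by auto
    have lin: "linear D" using D(1) has_derivative_linear by blast
    have "inj D"
      unfolding linear_injective_0[OF lin]
    proof (intro allI impI)
      fix h assume "D h = 0"
      then show "h = 0" using D(2)[of h] \<open>m > 0\<close> by (simp add: mult_le_0_iff)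
    qed
    then obtain D' where D': "linear D'" "\<And>h. D (D' h) = h"
      using linear_injective_isomorphism[OF lin] by blast
    \<comment> \<open>This form of the inverse function theorem takes \<open>f\<close> continuous
      with left inverse \<open>g\<close> on the whole ball and asks for an invertible derivative at
      \<open>x\<close> only.\<close>
    have "(g has_derivative D') (at (f x))"
      by (rule has_derivative_inverse_strong[OF open_ball x(1) contf gf D(1)]) (use D' in auto)
    moreover have "onorm D' \<le> inverse m"
    proof (rule onorm_le)
      fix h
      show "norm (D' h) \<le> inverse m * norm h"
        using D(2)[of "D' h"] D'(2)[of h] \<open>m > 0\<close> by (simp add: field_simps)
    qed
    ultimately show ?thesis using x by blast
  qed
  show ?thesis
  proof (rule ccontr)
    assume "\<not> ?thesis"
    then obtain y0 where y0: "y0 \<notin> ?W" "dist (f a) y0 < m * \<rho>"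
      by (metis mem_ball subsetI)
    have "closed (- ?W)" "- ?W \<noteq> {}" using openW y0 by auto
    then obtain y where y: "y \<notin> ?W" "\<And>z. z \<notin> ?W \<Longrightarrow> dist (f a) y \<le> dist (f a) z"
      using distance_attains_inf[of "- ?W" "f a"] by auto
    define s where "s = dist (f a) y"
    have s: "0 < s" "s < m * \<rho>"
      using y(2)[OF y0(1)] y0(2) aW y(1) by (auto simp: s_def)
    have sub: "ball (f a) s \<subseteq> ?W"
      using y(2) by (force simp: s_def)
    have lip: "dist a (g z) \<le> inverse m * s" if "z \<in> ball (f a) s" for z
    proof -
      obtain D' where D': "\<And>y. y \<in> ?W \<Longrightarrow> (g has_derivative D' y) (at y)"
        "\<And>y. y \<in> ?W \<Longrightarrow> onorm (D' y) \<le> inverse m"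
        using derg by metis
      have "norm (g z - g (f a)) \<le> inverse m * norm (z - f a)"
      proof (rule differentiable_bound[of "ball (f a) s"])
        fix y assume "y \<in> ball (f a) s"
        then have "y \<in> ?W" using sub by blast
        then show "(g has_derivative D' y) (at y within ball (f a) s)" "onorm (D' y) \<le> inverse m"
          using D' by (auto intro: has_derivative_at_withinI)
      qed (use that s in auto)
      also have "\<dots> \<le> inverse m * s"
        using that \<open>m > 0\<close> by (intro mult_left_mono) (auto simp: dist_norm norm_minus_commute)
      finally show ?thesis
        using gf[of a] \<open>\<rho> > 0\<close> by (simp add: dist_norm norm_minus_commute)
    qed
    \<comment> \<open>The closed ball of radius s / m stays inside the domain, so its image is
      compact and hence closed. It contains the ball about \<open>f a\<close> of radius
      \<open>s\<close>, and so also the boundary point \<open>y\<close>, the nearest point missed by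
      the image.\<close>
    have sm: "inverse m * s < \<rho>" using s \<open>m > 0\<close> by (simp add: field_simps)
    have "ball (f a) s \<subseteq> f ` cball a (inverse m * s)"
    proof
      fix z assume z: "z \<in> ball (f a) s"
      then have "f (g z) = z" using sub f_inv_into_f[of z f "ball a \<rho>"] by (auto simp: g_def)
      then show "z \<in> f ` cball a (inverse m * s)" using lip[OF z] by (metis image_eqI mem_cball)
    qed
    moreover have "compact (f ` cball a (inverse m * s))"
      by (intro compact_continuous_image continuous_on_subset[OF contf]) (use sm in auto)
    ultimately have "closure (ball (f a) s) \<subseteq> f ` cball a (inverse m * s)"
      by (simp add: closure_minimal compact_imp_closed)
    moreover have "y \<in> closure (ball (f a) s)"
      using s by (simp add: s_def)
    moreover have "f ` cball a (inverse m * s) \<subseteq> ?W" using sm by auto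
    ultimately show False using y(1) by blast
  qed
qed

section \<open>Derivative norms\<close>

lemma word_map_append: "word_map \<phi> (u @ v) = word_map \<phi> u \<circ> word_map \<phi> v"
  by (induction u) (auto simp: o_assoc)

lemma onorm_similarity:
  fixes D :: "'a::euclidean_space \<Rightarrow> 'a"
  assumes "\<And>h. norm (D h) = r * norm h" "r \<ge> 0"
  shows "onorm D = r"
proof (rule antisym)
  show "onorm D \<le> r" by (rule onorm_le) (simp add: assms(1))
  obtain b :: 'a where b: "b \<in> Basis" using nonempty_Basis by blast
  \<comment> \<open>At h = 0 the quotient is 0 / 0 = 0, which is where \<open>r \<ge> 0\<close> is
    used.\<close>
  have "bdd_above (range (\<lambda>h. norm (D h) / norm h))"
    using assms(2) by (intro bdd_aboveI[of _ r]) (auto simp: assms(1))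
  then have "norm (D b) / norm b \<le> onorm D"
    unfolding onorm_def by (intro cSUP_upper) auto
  then show "r \<le> onorm D" using b by (simp add: assms(1))
qed

context acifs
begin

lemma J_nonempty: "J \<noteq> {}"
  using J_interior interior_subset by fastforce

lemma word_map_V: "x \<in> V \<Longrightarrow> word_map \<phi> u x \<in> V"
proof (induction u)
  case (Cons i u)
  then show ?case using conformal[of i] by (auto simp: conformal_diffeo_into_def)
qed simp

lemma word_map_J: "x \<in> J \<Longrightarrow> word_map \<phi> u x \<in> J"
  using \<phi>_into by (induction u) auto

lemma inj_word_map: "inj_on (word_map \<phi> u) V"
proof (induction u)
  case (Cons i u)
  have "inj_on (\<phi> i) (word_map \<phi> u ` V)"
    using conformal[of i] word_map_V
    by (auto simp: conformal_diffeo_into_def intro: inj_on_subset)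
  then show ?case using comp_inj_on[OF Cons] by (simp only: word_map.simps)
qed simp

text \<open>Being a similarity is recorded through norms alone, so composing two derivatives just
  multiplies their ratios and the orthogonal parts can be forgotten.\<close>

lemma word_map_similarity_aux:
  "x \<in> V \<Longrightarrow> \<exists>D r. r > 0 \<and> (word_map \<phi> u has_derivative D) (at x) \<and> (\<forall>h. norm (D h) = r * norm h)"
proof (induction u)
  case Nil
  show ?case
    by (intro exI[of _ "\<lambda>h. h"] exI[of _ 1]) (auto simp: id_def)
next
  case (Cons i u)
  then obtain D r where D: "r > 0" "(word_map \<phi> u has_derivative D) (at x)" "\<And>h. norm (D h) = r * norm h"
    by auto
  let ?y = "word_map \<phi> u x"
  have y: "?y \<in> V" using word_map_V Cons by blast
  obtain f' where f': "(\<phi> i has_derivative blinfun_apply (f' ?y)) (at ?y)"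
    using conformal[of i] y unfolding conformal_diffeo_into_def C1_on_def by blast
  obtain s A where A: "s > 0" "orthogonal_transformation A" "frechet_derivative (\<phi> i) (at ?y) = (\<lambda>h. s *\<^sub>R A h)"
    using conformal[of i] y unfolding conformal_diffeo_into_def by blast
  have "(\<phi> i has_derivative (\<lambda>h. s *\<^sub>R A h)) (at ?y)"
    using f' frechet_derivative_at[OF f'] A(3) by simp
  then have "(word_map \<phi> (i # u) has_derivative (\<lambda>h. s *\<^sub>R A h) \<circ> D) (at x)"
    using D(2) by (simp add: diff_chain_at)
  moreover have "norm (((\<lambda>h. s *\<^sub>R A h) \<circ> D) h) = (s * r) * norm h" for h
    using A D by (simp add: orthogonal_transformation_norm)
  ultimately show ?case using A(1) D(1) by (meson mult_pos_pos)
qed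

lemma deriv_norm_atI:
  assumes "(word_map \<phi> u has_derivative D) (at x)" "\<And>h. norm (D h) = r * norm h" "r \<ge> 0"
  shows "deriv_norm_at \<phi> u x = r"
  unfolding deriv_norm_at_def frechet_derivative_at[OF assms(1), symmetric]
  by (rule onorm_similarity[OF assms(2,3)])

lemma word_map_similarity:
  assumes "x \<in> V"
  obtains D where "(word_map \<phi> u has_derivative D) (at x)"
    "\<And>h. norm (D h) = deriv_norm_at \<phi> u x * norm h" "deriv_norm_at \<phi> u x > 0"
  using word_map_similarity_aux[OF assms, of u] deriv_norm_atI by (metis less_imp_le)

text \<open>The chain rule yields an equality of norms, not only an inequality, because both
  derivatives are similarities.\<close>

lemma deriv_norm_at_append:
  assumes "x \<in> V"
  shows "deriv_norm_at \<phi> (u @ v) x = deriv_norm_at \<phi> u (word_map \<phi> v x) * deriv_norm_at \<phi> v x"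
proof -
  obtain D where D: "(word_map \<phi> v has_derivative D) (at x)"
    "\<And>h. norm (D h) = deriv_norm_at \<phi> v x * norm h" "deriv_norm_at \<phi> v x > 0"
    using word_map_similarity[OF assms] by blast
  obtain D' where D': "(word_map \<phi> u has_derivative D') (at (word_map \<phi> v x))"
    "\<And>h. norm (D' h) = deriv_norm_at \<phi> u (word_map \<phi> v x) * norm h" "deriv_norm_at \<phi> u (word_map \<phi> v x) > 0"
    using word_map_similarity[OF word_map_V[OF assms]] by blast
  show ?thesis
  proof (rule deriv_norm_atI)
    show "(word_map \<phi> (u @ v) has_derivative D' \<circ> D) (at x)"
      unfolding word_map_append by (rule diff_chain_at[OF D(1) D'(1)])
  qed (use D D' in auto)
qed

text \<open>Distortion also bounds the pointwise norms over \<open>J\<close>, without which the real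
  supremum in \<open>deriv_norm\<close> would carry no information. Afterwards the value at any
  point of \<open>V\<close> may replace the supremum at the cost of \<open>C\<close>.\<close>

lemma deriv_norm_bounds:
  obtains C where "C \<ge> 1" "\<And>u x. x \<in> J \<Longrightarrow> deriv_norm_at \<phi> u x \<le> deriv_norm J \<phi> u"
    "\<And>u x. x \<in> V \<Longrightarrow> deriv_norm_at \<phi> u x \<le> C * deriv_norm J \<phi> u"
    "\<And>u x. x \<in> V \<Longrightarrow> deriv_norm J \<phi> u \<le> C * deriv_norm_at \<phi> u x"
proof -
  obtain C where C: "C \<ge> 1" "\<And>u x y. x \<in> V \<Longrightarrow> y \<in> V \<Longrightarrow> deriv_norm_at \<phi> u x \<le> C * deriv_norm_at \<phi> u y"
    using bounded_distortion by blast
  obtain x0 where x0: "x0 \<in> J" using J_nonempty by blast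
  have upper: "deriv_norm_at \<phi> u x \<le> deriv_norm J \<phi> u" if "x \<in> J" for u x
    unfolding deriv_norm_def
  proof (rule cSUP_upper[OF that])
    show "bdd_above (deriv_norm_at \<phi> u ` J)"
      using C(2)[OF _ subsetD[OF J_subset_V x0], of _ u] J_subset_V
      by (intro bdd_aboveI[of _ "C * deriv_norm_at \<phi> u x0"]) auto
  qed
  have least: "deriv_norm J \<phi> u \<le> C * deriv_norm_at \<phi> u x" if "x \<in> V" for u x
    unfolding deriv_norm_def using C(2) that J_subset_V J_nonempty by (intro cSUP_least) auto
  have "deriv_norm_at \<phi> u x \<le> C * deriv_norm J \<phi> u" if "x \<in> V" for u x
  proof -
    have "deriv_norm_at \<phi> u x \<le> C * deriv_norm_at \<phi> u x0"
      using C(2)[OF that, of x0] x0 J_subset_V by auto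
    also have "\<dots> \<le> C * deriv_norm J \<phi> u"
      using upper[OF x0] C(1) by (intro mult_left_mono) auto
    finally show ?thesis .
  qed
  with C(1) upper least show ?thesis using that by blast
qed

lemma deriv_norm_pos: "deriv_norm J \<phi> u > 0"
proof -
  obtain x where x: "x \<in> J" using J_nonempty by blast
  then have "deriv_norm_at \<phi> u x > 0" using word_map_similarity[of x u] J_subset_V by blast
  then show ?thesis using x deriv_norm_bounds by (metis less_le_trans)
qed

text \<open>The constant is 1 because \<open>word_map \<phi> v\<close> maps \<open>J\<close> into
  itself, so the norm of the outer map is again taken at a point of \<open>J\<close>.\<close>

lemma deriv_norm_append_le: "deriv_norm J \<phi> (u @ v) \<le> deriv_norm J \<phi> u * deriv_norm J \<phi> v"
proof -
  obtain C where C: "\<And>u x. x \<in> J \<Longrightarrow> deriv_norm_at \<phi> u x \<le> deriv_norm J \<phi> u"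
    using deriv_norm_bounds by metis
  have pos: "deriv_norm_at \<phi> u x > 0" if "x \<in> J" for u x
    using word_map_similarity[of x u] J_subset_V that by blast
  show ?thesis
    unfolding deriv_norm_def[of J \<phi> "u @ v"]
  proof (rule cSUP_least[OF J_nonempty])
    fix x assume x: "x \<in> J"
    show "deriv_norm_at \<phi> (u @ v) x \<le> deriv_norm J \<phi> u * deriv_norm J \<phi> v"
      using x J_subset_V C word_map_J[OF x] pos deriv_norm_pos[of u]
      by (subst deriv_norm_at_append) (auto intro!: mult_mono intro: less_imp_le)
  qed
qed

text \<open>The exact chain rule is evaluated at one point; replacing the supremum by a value costs
  \<open>C\<close> once for \<open>u\<close> and once for \<open>v\<close>, whence C * C.\<close>

lemma deriv_norm_append_ge:
  obtains C where "C \<ge> 1" "\<And>u v. deriv_norm J \<phi> u * deriv_norm J \<phi> v \<le> C * deriv_norm J \<phi> (u @ v)"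
proof -
  obtain C where C: "C \<ge> 1" "\<And>u x. x \<in> J \<Longrightarrow> deriv_norm_at \<phi> u x \<le> deriv_norm J \<phi> u"
    "\<And>u x. x \<in> V \<Longrightarrow> deriv_norm J \<phi> u \<le> C * deriv_norm_at \<phi> u x"
    using deriv_norm_bounds by metis
  obtain x where x: "x \<in> J" "x \<in> V" using J_nonempty J_subset_V by blast
  have "deriv_norm J \<phi> u * deriv_norm J \<phi> v \<le> C * C * deriv_norm J \<phi> (u @ v)" for u v
  proof -
    have "deriv_norm J \<phi> u * deriv_norm J \<phi> v \<le> (C * deriv_norm_at \<phi> u (word_map \<phi> v x)) * (C * deriv_norm_at \<phi> v x)"
    proof (rule mult_mono)
      show "0 \<le> C * deriv_norm_at \<phi> u (word_map \<phi> v x)"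
        using C(1,3) word_map_V[OF x(2)] deriv_norm_pos[of u] by (meson less_imp_le order_trans)
    qed (use C(3) x word_map_V deriv_norm_pos[of v] in auto)
    also have "\<dots> = C * C * deriv_norm_at \<phi> (u @ v) x"
      by (simp add: deriv_norm_at_append[OF x(2)])
    also have "\<dots> \<le> C * C * deriv_norm J \<phi> (u @ v)"
      using C(1) C(2)[OF x(1)] by (intro mult_left_mono) auto
    finally show ?thesis .
  qed
  moreover have "C * C \<ge> 1" using C(1) by (metis mult_mono' mult_1 zero_le_one)
  ultimately show ?thesis using that by blast
qed

lemma deriv_norm_Nil: "deriv_norm J \<phi> [] = 1"
proof -
  have "deriv_norm_at \<phi> [] x = 1" for x
    by (rule deriv_norm_atI[of _ "\<lambda>h. h"]) (auto simp: id_def)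
  then show ?thesis using J_nonempty by (simp add: deriv_norm_def)
qed

text \<open>The contraction hypothesis concerns differences within \<open>J\<close>, so it bounds
  the derivative directly at an interior point of \<open>J\<close>, where difference quotients are
  available. Distortion carries the bound to the supremum.\<close>

lemma deriv_norm_decay:
  obtains C c where "C \<ge> 1" "0 < c" "c < 1" "\<And>u. deriv_norm J \<phi> u \<le> C * c ^ length u"
proof -
  obtain C where C: "C \<ge> 1" "\<And>u x. x \<in> V \<Longrightarrow> deriv_norm J \<phi> u \<le> C * deriv_norm_at \<phi> u x"
    using deriv_norm_bounds by metis
  obtain c where c: "0 < c" "c < 1"
    "\<And>i x y. x \<in> J \<Longrightarrow> y \<in> J \<Longrightarrow> norm (\<phi> i x - \<phi> i y) \<le> c * norm (x - y)"
    using contraction by blast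
  have lip: "norm (word_map \<phi> u x - word_map \<phi> u y) \<le> c ^ length u * norm (x - y)"
    if "x \<in> J" "y \<in> J" for u x y
  proof (induction u)
    case (Cons i u)
    have "norm (word_map \<phi> (i # u) x - word_map \<phi> (i # u) y) \<le> c * norm (word_map \<phi> u x - word_map \<phi> u y)"
      using c(3) word_map_J that by simp
    also have "\<dots> \<le> c * (c ^ length u * norm (x - y))"
      using Cons c by (intro mult_left_mono) auto
    finally show ?case by simp
  qed simp
  obtain x where x: "x \<in> interior J" using J_interior by blast
  then have xJ: "x \<in> J" "x \<in> V" using interior_subset J_subset_V by blast+
  have "deriv_norm_at \<phi> u x \<le> c ^ length u" for u
  proof -
    obtain D where D: "(word_map \<phi> u has_derivative D) (at x)"
      "\<And>h. norm (D h) = deriv_norm_at \<phi> u x * norm h"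
      using word_map_similarity[OF xJ(2), of u] by blast
    show ?thesis
    proof (rule field_le_epsilon)
      fix e :: real assume "e > 0"
      then obtain d where d: "d > 0" "\<And>y. norm (y - x) < d \<Longrightarrow>
          norm (word_map \<phi> u y - word_map \<phi> u x - D (y - x)) \<le> e * norm (y - x)"
        using D(1) unfolding has_derivative_at_alt by blast
      obtain r where r: "r > 0" "ball x r \<subseteq> J" using x by (auto simp: mem_interior)
      obtain b :: "real^'d" where b: "norm b = 1" using vector_choose_size[of 1] by auto
      \<comment> \<open>Near enough to \<open>x\<close> for the differentiability estimate and still
        inside the ball contained in \<open>J\<close>. One direction suffices, as the derivative
        scales all vectors equally.\<close>
      define y where "y = x + (min d r / 2) *\<^sub>R b"
      have y: "norm (y - x) = min d r / 2" using b d r by (simp add: y_def)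
      then have yJ: "y \<in> J" using r d by (auto simp: dist_norm norm_minus_commute subset_iff)
      have "deriv_norm_at \<phi> u x * norm (y - x) = norm (D (y - x))" by (simp add: D(2))
      also have "\<dots> \<le> norm (word_map \<phi> u y - word_map \<phi> u x) + norm (word_map \<phi> u y - word_map \<phi> u x - D (y - x))"
        by (metis norm_triangle_sub norm_minus_commute)
      also have "\<dots> \<le> c ^ length u * norm (y - x) + e * norm (y - x)"
        using d r y by (intro add_mono lip[OF yJ xJ(1)] d(2)) auto
      finally have "deriv_norm_at \<phi> u x * norm (y - x) \<le> (c ^ length u + e) * norm (y - x)"
        by (simp add: algebra_simps)
      moreover have "norm (y - x) > 0" using y d r by auto
      ultimately show "deriv_norm_at \<phi> u x \<le> c ^ length u + e" by simp
    qed
  qed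
  then have "deriv_norm J \<phi> u \<le> C * c ^ length u" for u
    using C(2)[OF xJ(2), of u] C(1) by (meson mult_left_mono order_trans zero_le_one)
  then show ?thesis using that C(1) c(1,2) by blast
qed

end

section \<open>Moment sums and mesh cubes\<close>

text \<open>Two-sided bounds make ln of the moment sum equal to (q - 1) s ln \<delta> up to a
  bounded error, and dividing by (q - 1) ln \<delta>, which is unbounded as \<delta> tends to 0,
  removes the error.\<close>

lemma has_gen_dimI:
  assumes "A > 0" "B > 0" "q \<noteq> 1"
    and moment: "\<And>\<delta>. 0 < \<delta> \<Longrightarrow> \<delta> < 1 \<Longrightarrow>
      \<exists>m. moment_sum q \<nu> \<delta> = ennreal m \<and> A * \<delta> powr ((q - 1) * s) \<le> m \<and> m \<le> B * \<delta> powr ((q - 1) * s)"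
  shows "has_gen_dim q \<nu> (ereal s)"
proof -
  obtain m where m: "moment_sum q \<nu> \<delta> = ennreal (m \<delta>)"
    "A * \<delta> powr ((q - 1) * s) \<le> m \<delta>" "m \<delta> \<le> B * \<delta> powr ((q - 1) * s)"
    if "0 < \<delta>" "\<delta> < 1" for \<delta>
    using moment by metis
  define H where "H = \<bar>ln A\<bar> + \<bar>ln B\<bar>"
  have m_pos: "m \<delta> > 0" if "0 < \<delta>" "\<delta> < 1" for \<delta>
  proof -
    have "0 < A * \<delta> powr ((q - 1) * s)" using \<open>A > 0\<close> that by simp
    then show ?thesis using m(2)[OF that] by linarith
  qed
  have ln_m: "\<bar>ln (m \<delta>) - (q - 1) * s * ln \<delta>\<bar> \<le> H" if "0 < \<delta>" "\<delta> < 1" for \<delta>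
  proof -
    have "ln (A * \<delta> powr ((q - 1) * s)) \<le> ln (m \<delta>)" "ln (m \<delta>) \<le> ln (B * \<delta> powr ((q - 1) * s))"
      using m(2,3)[OF that] m_pos[OF that] assms(1,2) that by (auto intro!: ln_mono)
    then show ?thesis
      using assms(1,2) that by (simp add: ln_mult ln_powr H_def)
  qed
  define f where "f \<delta> = ln (m \<delta>) / ((q - 1) * ln \<delta>)" for \<delta>
  have ev: "\<forall>\<^sub>F \<delta> in at_right (0::real). 0 < \<delta> \<and> \<delta> < 1"
    using eventually_at_right_real[OF zero_less_one[where 'a = real]] by simp
  have lim0: "((\<lambda>\<delta>. H / \<bar>q - 1\<bar> * \<bar>inverse (ln \<delta>)\<bar>) \<longlongrightarrow> 0) (at_right (0::real))"
  proof -
    have "filterlim ln at_infinity (at_right (0::real))"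
      by (rule filterlim_mono[OF ln_at_0 at_bot_le_at_infinity order_refl])
    then have "((\<lambda>\<delta>. inverse (ln \<delta>)) \<longlongrightarrow> 0) (at_right (0::real))"
      by (rule filterlim_compose[OF tendsto_inverse_0])
    then show ?thesis
      by (intro tendsto_mult_right_zero tendsto_rabs_zero)
  qed
  have "((\<lambda>\<delta>. f \<delta> - s) \<longlongrightarrow> 0) (at_right 0)"
  proof (rule Lim_null_comparison[OF _ lim0])
    show "\<forall>\<^sub>F \<delta> in at_right 0. norm (f \<delta> - s) \<le> H / \<bar>q - 1\<bar> * \<bar>inverse (ln \<delta>)\<bar>"
      using ev
    proof eventually_elim
      fix \<delta> :: real assume \<delta>: "0 < \<delta> \<and> \<delta> < 1"
      then have "f \<delta> - s = (ln (m \<delta>) - (q - 1) * s * ln \<delta>) / ((q - 1) * ln \<delta>)"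
        using \<open>q \<noteq> 1\<close> by (simp add: f_def field_simps)
      then have "norm (f \<delta> - s) = \<bar>ln (m \<delta>) - (q - 1) * s * ln \<delta>\<bar> / (\<bar>q - 1\<bar> * \<bar>ln \<delta>\<bar>)"
        by (simp add: abs_mult)
      also have "\<dots> \<le> H / (\<bar>q - 1\<bar> * \<bar>ln \<delta>\<bar>)"
        by (intro divide_right_mono ln_m mult_nonneg_nonneg abs_ge_zero) (use \<delta> in auto)
      finally show "norm (f \<delta> - s) \<le> H / \<bar>q - 1\<bar> * \<bar>inverse (ln \<delta>)\<bar>"
        by (simp add: field_simps)
    qed
  qed
  then have "(f \<longlongrightarrow> s) (at_right 0)" by (simp add: LIM_zero_iff)
  then have "((\<lambda>\<delta>. ereal (f \<delta>)) \<longlongrightarrow> ereal s) (at_right 0)" by simp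
  moreover have "\<forall>\<^sub>F \<delta> in at_right 0. ereal (f \<delta>) = ln_ext (moment_sum q \<nu> \<delta>) / ereal ((q - 1) * ln \<delta>)"
    using ev
  proof eventually_elim
    fix \<delta> :: real assume "0 < \<delta> \<and> \<delta> < 1"
    then have \<delta>: "0 < \<delta>" "\<delta> < 1" by auto
    have "ln_ext (moment_sum q \<nu> \<delta>) = ereal (ln (m \<delta>))"
      using m_pos[OF \<delta>] by (simp add: m(1)[OF \<delta>] ln_ext_def ennreal_eq_0_iff)
    then show "ereal (f \<delta>) = ln_ext (moment_sum q \<nu> \<delta>) / ereal ((q - 1) * ln \<delta>)"
      using \<delta> \<open>q \<noteq> 1\<close> by (simp add: f_def)
  qed
  ultimately have "((\<lambda>\<delta>. ln_ext (moment_sum q \<nu> \<delta>) / ereal ((q - 1) * ln \<delta>)) \<longlongrightarrow> ereal s) (at_right 0)"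
    by (rule Lim_transform_eventually)
  then show ?thesis
    unfolding has_gen_dim_def lower_gen_dim_def upper_gen_dim_def
    by (auto intro!: lim_imp_Liminf lim_imp_Limsup)
qed

text \<open>A sum of at most \<open>N\<close> terms is at most \<open>N\<close> times its largest
  term, whose q-th power is at most the sum of the q-th powers. This holds for every q > 0, without
  convexity or concavity. Exchanging the order of summation then counts each \<open>u\<close> at
  most \<open>M\<close> times.\<close>

lemma sum_powr_double_counting:
  fixes f :: "'b \<Rightarrow> real" and g :: "'c \<Rightarrow> real"
  assumes fin: "finite A" "finite B" and "q > 0" "N \<ge> 0" "M \<ge> 0"
    and f: "\<And>u. u \<in> A \<Longrightarrow> f u \<ge> 0" and g: "\<And>v. v \<in> B \<Longrightarrow> g v \<ge> 0"
    and le: "\<And>v. v \<in> B \<Longrightarrow> g v \<le> (\<Sum>u | u \<in> A \<and> r u v. f u)"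
    and N: "\<And>v. v \<in> B \<Longrightarrow> real (card {u\<in>A. r u v}) \<le> N"
    and M: "\<And>u. u \<in> A \<Longrightarrow> real (card {v\<in>B. r u v}) \<le> M"
  shows "(\<Sum>v\<in>B. g v powr q) \<le> N powr q * M * (\<Sum>u\<in>A. f u powr q)"
proof -
  have single: "g v powr q \<le> N powr q * (\<Sum>u | u \<in> A \<and> r u v. f u powr q)" if v: "v \<in> B" for v
  proof (cases "{u\<in>A. r u v} = {}")
    case True
    then have "g v = 0" using le[OF v] g[OF v] by (metis antisym sum.empty)
    then show ?thesis using \<open>N \<ge> 0\<close> by (simp add: sum_nonneg)
  next
    case False
    let ?X = "{u\<in>A. r u v}"
    have finX: "finite ?X" using fin by simp
    have "Max (f ` ?X) \<in> f ` ?X" using finX False by (intro Max_in) auto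
    then obtain u0 where "u0 \<in> ?X" "Max (f ` ?X) = f u0" by blast
    moreover have "f u \<le> Max (f ` ?X)" if "u \<in> ?X" for u using finX that by (intro Max_ge) auto
    ultimately have u0: "u0 \<in> ?X" "\<And>u. u \<in> ?X \<Longrightarrow> f u \<le> f u0" by auto
    have "g v \<le> real (card ?X) * f u0"
      using le[OF v] sum_bounded_above[of ?X f "f u0"] u0 by (meson order_trans)
    also have "\<dots> \<le> N * f u0"
      using N[OF v] f u0 by (intro mult_right_mono) auto
    finally have "g v powr q \<le> (N * f u0) powr q"
      using g[OF v] \<open>q > 0\<close> by (intro powr_mono2) auto
    also have "\<dots> = N powr q * f u0 powr q"
      using f u0 \<open>N \<ge> 0\<close> by (simp add: powr_mult)
    also have "\<dots> \<le> N powr q * (\<Sum>u\<in>?X. f u powr q)"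
      using u0 finX by (intro mult_left_mono member_le_sum) auto
    finally show ?thesis .
  qed
  have "(\<Sum>v\<in>B. g v powr q) \<le> (\<Sum>v\<in>B. N powr q * (\<Sum>u | u \<in> A \<and> r u v. f u powr q))"
    by (intro sum_mono single)
  also have "\<dots> = N powr q * (\<Sum>v\<in>B. \<Sum>u | u \<in> A \<and> r u v. f u powr q)"
    by (simp add: sum_distrib_left)
  also have "(\<Sum>v\<in>B. \<Sum>u | u \<in> A \<and> r u v. f u powr q) = (\<Sum>u\<in>A. \<Sum>v | v \<in> B \<and> r u v. f u powr q)"
    by (rule sum.swap_restrict[OF fin(2,1)])
  also have "\<dots> = (\<Sum>u\<in>A. real (card {v\<in>B. r u v}) * f u powr q)"
    by simp
  also have "\<dots> \<le> (\<Sum>u\<in>A. M * f u powr q)"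
    by (intro sum_mono mult_right_mono M) auto
  also have "\<dots> = M * (\<Sum>u\<in>A. f u powr q)" by (simp add: sum_distrib_left)
  finally show ?thesis by (simp add: mult_left_mono mult.assoc)
qed

section \<open>Mesh cubes: covering, diameter, measurability and counting\<close>

lemma mesh_cubes_cover:
  fixes x :: "real^'d"
  assumes "\<delta> > 0"
  obtains Q where "Q \<in> mesh_cubes \<delta>" "x \<in> Q"
proof -
  define m :: "int^'d" where "m = (\<chi> j. \<lfloor>x $ j / \<delta>\<rfloor>)"
  have "of_int (m $ j) * \<delta> \<le> x $ j \<and> x $ j < (of_int (m $ j) + 1) * \<delta>" for j
  proof -
    have "of_int (m $ j) \<le> x $ j / \<delta>" "x $ j / \<delta> < of_int (m $ j) + 1"
      by (simp_all add: m_def)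
    then show ?thesis using assms by (simp_all only: pos_le_divide_eq pos_divide_less_eq)
  qed
  then show ?thesis
    by (intro that[of "{y. \<forall>j. of_int (m $ j) * \<delta> \<le> y $ j \<and> y $ j < (of_int (m $ j) + 1) * \<delta>}"])
      (auto simp: mesh_cubes_def)
qed

lemma mesh_cubes_dist_le:
  fixes x :: "real^'d"
  assumes "Q \<in> mesh_cubes \<delta>" "x \<in> Q" "y \<in> Q"
  shows "dist x y \<le> real CARD('d) * \<delta>"
proof -
  have "\<bar>x $ j - y $ j\<bar> \<le> \<delta>" for j
  proof -
    obtain m :: "int^'d" where "of_int (m $ j) * \<delta> \<le> x $ j" "x $ j < (of_int (m $ j) + 1) * \<delta>"
      "of_int (m $ j) * \<delta> \<le> y $ j" "y $ j < (of_int (m $ j) + 1) * \<delta>"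
      using assms unfolding mesh_cubes_def by auto
    then show ?thesis by (simp add: algebra_simps)
  qed
  then have "(\<Sum>j\<in>UNIV. \<bar>(x - y) $ j\<bar>) \<le> real CARD('d) * \<delta>"
    using sum_bounded_above[of UNIV "\<lambda>j. \<bar>(x - y) $ j\<bar>" \<delta>] by simp
  then show ?thesis using norm_le_l1_cart[of "x - y"] by (simp add: dist_norm)
qed

lemma mesh_cubes_borel:
  fixes Q :: "(real^'d) set"
  shows "Q \<in> mesh_cubes \<delta> \<Longrightarrow> Q \<in> sets borel"
proof -
  assume "Q \<in> mesh_cubes \<delta>"
  then obtain m :: "int^'d" where
    "Q = {x. \<forall>j. of_int (m $ j) * \<delta> \<le> x $ j \<and> x $ j < (of_int (m $ j) + 1) * \<delta>}"
    unfolding mesh_cubes_def by blast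
  then have "Q = (\<Inter>j. {x. of_int (m $ j) * \<delta> \<le> x $ j} \<inter> {x. x $ j < (of_int (m $ j) + 1) * \<delta>})"
    by auto
  also have "\<dots> \<in> sets borel"
    by (intro sets.countable_INT'' sets.Int borel_closed borel_open
        closed_Collect_le open_Collect_less continuous_intros) auto
  finally show ?thesis .
qed

lemma finite_int_vectors: "finite {v :: int^'d. \<forall>j. v $ j \<in> {-R..R}}"
proof -
  have "(\<lambda>v. ($) v) ` {v :: int^'d. \<forall>j. v $ j \<in> {-R..R}} \<subseteq> Pi\<^sub>E UNIV (\<lambda>_. {-R..R})"
    by auto
  then have "finite ((\<lambda>v. ($) v) ` {v :: int^'d. \<forall>j. v $ j \<in> {-R..R}})"
    by (rule finite_subset) (auto intro: finite_PiE)
  then show ?thesis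
    by (rule finite_imageD) (auto simp: inj_on_def vec_eq_iff)
qed

text \<open>After division by \<delta> the set has diameter at most \<open>L\<close>, so the integer
  indices of the cubes it meets stay in a fixed box around one of them. The bound is the number of
  integer vectors in that box, chosen before \<delta> and the set.\<close>

lemma card_mesh_cubes_meeting:
  fixes L :: real
  obtains M where "M \<ge> 0" "\<And>\<delta> (A :: (real^'d) set). \<delta> > 0 \<Longrightarrow> (\<And>x y. x \<in> A \<Longrightarrow> y \<in> A \<Longrightarrow> dist x y \<le> L * \<delta>) \<Longrightarrow>
    finite {Q \<in> mesh_cubes \<delta>. Q \<inter> A \<noteq> {}} \<and> real (card {Q \<in> mesh_cubes \<delta>. Q \<inter> A \<noteq> {}}) \<le> M"
proof -
  \<comment> \<open>Floors of two reals at distance at most \<open>L\<close> differ by less than L +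
    1.\<close>
  define R where "R = \<lceil>L\<rceil> + 1"
  define B where "B = {v :: int^'d. \<forall>j. v $ j \<in> {-R..R}}"
  have finB: "finite B" unfolding B_def by (rule finite_int_vectors)
  have "finite {Q \<in> mesh_cubes \<delta>. Q \<inter> A \<noteq> {}} \<and> real (card {Q \<in> mesh_cubes \<delta>. Q \<inter> A \<noteq> {}}) \<le> real (card B)"
    if \<delta>: "\<delta> > 0" and diam: "\<And>x y. x \<in> A \<Longrightarrow> y \<in> A \<Longrightarrow> dist x y \<le> L * \<delta>" for \<delta> and A :: "(real^'d) set"
  proof (cases "A = {}")
    case False
    then obtain x where x: "x \<in> A" by blast
    define k :: "int^'d" where "k = (\<chi> j. \<lfloor>x $ j / \<delta>\<rfloor>)"
    define cube :: "int^'d \<Rightarrow> (real^'d) set" where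
      "cube m = {x. \<forall>j. of_int (m $ j) * \<delta> \<le> x $ j \<and> x $ j < (of_int (m $ j) + 1) * \<delta>}" for m
    have "{Q \<in> mesh_cubes \<delta>. Q \<inter> A \<noteq> {}} \<subseteq> (\<lambda>v. cube (k + v)) ` B"
    proof
      fix Q assume "Q \<in> {Q \<in> mesh_cubes \<delta>. Q \<inter> A \<noteq> {}}"
      then obtain m y where m: "Q = cube m" and y: "y \<in> A" "y \<in> cube m"
        by (auto simp: mesh_cubes_def cube_def)
      have "(m - k) $ j \<in> {-R..R}" for j
      proof -
        have "\<bar>y $ j - x $ j\<bar> \<le> L * \<delta>"
          using diam[OF y(1) x] component_le_norm_cart[of "y - x" j] by (simp add: dist_norm)
        then have "\<bar>(y $ j - x $ j) / \<delta>\<bar> \<le> L"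
          using \<delta> by (simp add: pos_divide_le_eq)
        then have 1: "\<bar>y $ j / \<delta> - x $ j / \<delta>\<bar> \<le> L" by (simp add: diff_divide_distrib)
        have 2: "of_int (m $ j) \<le> y $ j / \<delta>" "y $ j / \<delta> < of_int (m $ j) + 1"
          using y(2) \<delta> by (auto simp: cube_def pos_le_divide_eq pos_divide_less_eq)
        have "\<lfloor>y $ j / \<delta>\<rfloor> = m $ j" using 2 by (simp add: floor_eq_iff)
        then have "m $ j - k $ j = \<lfloor>y $ j / \<delta>\<rfloor> - \<lfloor>x $ j / \<delta>\<rfloor>" by (simp add: k_def)
        then show ?thesis using 1 unfolding R_def by (simp add: vector_minus_component) linarith
      qed
      then have "m - k \<in> B" by (simp add: B_def)
      then show "Q \<in> (\<lambda>v. cube (k + v)) ` B"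
        by (intro image_eqI[of _ _ "m - k"]) (simp_all add: m)
    qed
    then have "finite {Q \<in> mesh_cubes \<delta>. Q \<inter> A \<noteq> {}}" "card {Q \<in> mesh_cubes \<delta>. Q \<inter> A \<noteq> {}} \<le> card B"
      using finite_subset[OF _ finite_imageI[OF finB]] surj_card_le[OF finB] by blast+
    then show ?thesis by simp
  qed simp
  then show ?thesis using that[of "real (card B)"] by simp
qed

section \<open>Geometry of the pieces\<close>

context acifs
begin

lemma word_map_ball_diff:
  assumes "\<And>x. x \<in> V \<Longrightarrow> deriv_norm_at \<phi> u x \<le> B" "ball x r \<subseteq> V" "y \<in> ball x r"
  shows "norm (word_map \<phi> u x - word_map \<phi> u y) \<le> B * norm (x - y)"
proof (rule differentiable_bound[of "ball x r"])
  fix z assume "z \<in> ball x r"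
  then have z: "z \<in> V" using assms by blast
  obtain D where D: "(word_map \<phi> u has_derivative D) (at z)"
    "\<And>h. norm (D h) = deriv_norm_at \<phi> u z * norm h" "deriv_norm_at \<phi> u z > 0"
    using word_map_similarity[OF z] by blast
  show "(word_map \<phi> u has_derivative frechet_derivative (word_map \<phi> u) (at z)) (at z within ball x r)"
    using D(1) frechet_derivative_at has_derivative_at_withinI by blast
  show "onorm (frechet_derivative (word_map \<phi> u) (at z)) \<le> B"
    using assms(1)[OF z] by (simp add: deriv_norm_at_def)
next
  show "x \<in> ball x r" using assms(3) by (metis centre_in_ball empty_iff ball_eq_empty not_le)
qed (use assms in auto)

text \<open>\<open>J\<close> need not be connected, so the mean value inequality is chained through balls in \<open>V\<close>.\<close>

lemma word_map_diff_le:
  obtains L where "L > 0" "\<And>u x y. x \<in> J \<Longrightarrow> y \<in> J \<Longrightarrow> norm (word_map \<phi> u x - word_map \<phi> u y) \<le> L * deriv_norm J \<phi> u"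
proof -
  obtain C where C: "C \<ge> 1" "\<And>u x. x \<in> V \<Longrightarrow> deriv_norm_at \<phi> u x \<le> C * deriv_norm J \<phi> u"
    using deriv_norm_bounds by metis
  \<comment> \<open>The constant may depend on the two points but not on the word. This is an
    equivalence relation with open classes, hence a single class on the connected set
    \<open>V\<close>.\<close>
  define R where "R x y \<longleftrightarrow> (\<exists>L. \<forall>u. norm (word_map \<phi> u x - word_map \<phi> u y) \<le> L * deriv_norm J \<phi> u)" for x y
  have near: "norm (word_map \<phi> u x - word_map \<phi> u y) \<le> C * r * deriv_norm J \<phi> u"
    if "ball x r \<subseteq> V" "y \<in> ball x r" for x y r u
  proof -
    have "norm (word_map \<phi> u x - word_map \<phi> u y) \<le> C * deriv_norm J \<phi> u * norm (x - y)"
      by (rule word_map_ball_diff[OF C(2) that])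
    also have "\<dots> \<le> C * deriv_norm J \<phi> u * r"
      using that C(1) deriv_norm_pos[of u] by (intro mult_left_mono) (auto simp: dist_norm)
    finally show ?thesis by (simp add: ac_simps)
  qed
  have trans: "R x z" if xy: "R x y" and yz: "R y z" for x y z
  proof -
    obtain L where L: "\<And>u. norm (word_map \<phi> u x - word_map \<phi> u y) \<le> L * deriv_norm J \<phi> u"
      using xy unfolding R_def by blast
    obtain L' where "\<And>u. norm (word_map \<phi> u y - word_map \<phi> u z) \<le> L' * deriv_norm J \<phi> u"
      using yz unfolding R_def by blast
    with L have "norm (word_map \<phi> u x - word_map \<phi> u z) \<le> (L + L') * deriv_norm J \<phi> u" for u
      using norm_triangle_le[of "word_map \<phi> u x - word_map \<phi> u y" "word_map \<phi> u y - word_map \<phi> u z"]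
      by (simp add: distrib_right add_mono)
    then show ?thesis unfolding R_def by blast
  qed
  obtain x0 where x0: "x0 \<in> J" using J_nonempty by blast
  have R: "R x0 x" if "x \<in> V" for x
  proof (rule connected_equivalence_relation[OF V_connected])
    show "x0 \<in> V" "x \<in> V" using x0 J_subset_V that by auto
    show "R y x" if "R x y" for x y using that unfolding R_def by (simp add: norm_minus_commute)
    fix a assume "a \<in> V"
    then obtain r where r: "r > 0" "ball a r \<subseteq> V" using V_open open_contains_ball by blast
    have "R a y" if "y \<in> ball a r" for y
      unfolding R_def using near[OF r(2) that] by blast
    moreover have "openin (top_of_set V) (ball a r)"
      using r(2) V_open by (simp add: openin_open_eq)
    ultimately show "\<exists>T. openin (top_of_set V) T \<and> a \<in> T \<and> (\<forall>x\<in>T. R a x)"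
      using r(1) by (intro exI[of _ "ball a r"]) auto
  qed (use trans in blast)
  \<comment> \<open>Connectedness gives a constant for each point separately. The interiors make
    these sets open, so compactness of \<open>J\<close> selects one constant for all of its
    points.\<close>
  define U where "U n = interior {y. \<forall>u. norm (word_map \<phi> u x0 - word_map \<phi> u y) \<le> real n * deriv_norm J \<phi> u}" for n
  have "J \<subseteq> (\<Union>n. U n)"
  proof
    fix x assume "x \<in> J"
    then have xV: "x \<in> V" using J_subset_V by blast
    then obtain r where r: "r > 0" "ball x r \<subseteq> V" using V_open open_contains_ball by blast
    obtain L where L: "\<And>u. norm (word_map \<phi> u x0 - word_map \<phi> u x) \<le> L * deriv_norm J \<phi> u"
      using R[OF xV] unfolding R_def by blast
    obtain n where n: "L + C * r \<le> real n" using real_arch_simple by blast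
    have "ball x r \<subseteq> {y. \<forall>u. norm (word_map \<phi> u x0 - word_map \<phi> u y) \<le> real n * deriv_norm J \<phi> u}"
    proof clarify
      fix y u assume y: "y \<in> ball x r"
      have "norm (word_map \<phi> u x0 - word_map \<phi> u y) \<le> (L + C * r) * deriv_norm J \<phi> u"
        using norm_triangle_le[OF add_mono[OF L[of u] near[OF r(2) y, of u]]] by (simp add: distrib_right)
      also have "\<dots> \<le> real n * deriv_norm J \<phi> u"
        using n deriv_norm_pos[of u] by (intro mult_right_mono) auto
      finally show "norm (word_map \<phi> u x0 - word_map \<phi> u y) \<le> real n * deriv_norm J \<phi> u" .
    qed
    then have "x \<in> U n" unfolding U_def by (intro interiorI[of "ball x r"]) (use r in auto)
    then show "x \<in> (\<Union>n. U n)" by blast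
  qed
  then obtain I where I: "finite I" "J \<subseteq> (\<Union>n\<in>I. U n)"
    using compactE_image[OF J_compact, of UNIV U] by (auto simp: U_def)
  define n where "n = Max (insert 1 I)"
  have le: "norm (word_map \<phi> u x0 - word_map \<phi> u y) \<le> real n * deriv_norm J \<phi> u" if y: "y \<in> J" for y u
  proof -
    obtain k where k: "k \<in> I" "y \<in> U k" using I y by blast
    then have "norm (word_map \<phi> u x0 - word_map \<phi> u y) \<le> real k * deriv_norm J \<phi> u"
      using interior_subset unfolding U_def by blast
    also have "\<dots> \<le> real n * deriv_norm J \<phi> u"
      using k I deriv_norm_pos[of u] by (intro mult_right_mono) (auto simp: n_def)
    finally show ?thesis .
  qed
  have "norm (word_map \<phi> u x - word_map \<phi> u y) \<le> (2 * real n) * deriv_norm J \<phi> u" if "x \<in> J" "y \<in> J" for u x y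
    using norm_triangle_ineq4[of "word_map \<phi> u x0 - word_map \<phi> u y" "word_map \<phi> u x0 - word_map \<phi> u x"]
      le[OF that(1), of u] le[OF that(2), of u] by simp
  moreover have "real n > 0" using I by (simp add: n_def Max_gr_iff)
  ultimately show ?thesis using that[of "2 * real n"] by simp
qed

lemma Js_dist_le:
  obtains L where "L > 0" "\<And>u x y. x \<in> Js u \<Longrightarrow> y \<in> Js u \<Longrightarrow> dist x y \<le> L * deriv_norm J \<phi> u"
proof -
  obtain L where L: "L > 0" "\<And>u x y. x \<in> J \<Longrightarrow> y \<in> J \<Longrightarrow> norm (word_map \<phi> u x - word_map \<phi> u y) \<le> L * deriv_norm J \<phi> u"
    using word_map_diff_le by blast
  have "dist x y \<le> L * deriv_norm J \<phi> u" if xy: "x \<in> Js u" "y \<in> Js u" for u x y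
  proof -
    obtain \<omega> where "Js u = (\<lambda>x. word_map \<phi> u x + \<omega>) ` J" using Js_translate by blast
    then show ?thesis using xy L(2) by (auto simp: dist_norm)
  qed
  then show ?thesis using that L(1) by blast
qed

lemma Js_nonempty: "Js u \<noteq> {}"
  using Js_translate[of u] J_nonempty by auto

text \<open>One ball of radius \<rho> inside \<open>J\<close> is transported by every word map. By
  distortion the derivative stretches it everywhere by at least the derivative norm over
  \<open>C\<close>, and the translation only moves the centre; hence b = \<rho> / C.\<close>

lemma Js_contains_ball:
  obtains b where "b > 0" "\<And>u. \<exists>z. ball z (b * deriv_norm J \<phi> u) \<subseteq> Js u"
proof -
  obtain C where C: "C \<ge> 1" "\<And>u x. x \<in> V \<Longrightarrow> deriv_norm J \<phi> u \<le> C * deriv_norm_at \<phi> u x"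
    using deriv_norm_bounds by metis
  obtain x where "x \<in> interior J" using J_interior by blast
  then obtain \<rho> where \<rho>: "\<rho> > 0" "ball x \<rho> \<subseteq> J" by (auto simp: mem_interior)
  have "\<exists>z. ball z ((\<rho> / C) * deriv_norm J \<phi> u) \<subseteq> Js u" for u
  proof -
    obtain \<omega> where \<omega>: "Js u = (\<lambda>x. word_map \<phi> u x + \<omega>) ` J" using Js_translate by blast
    have "ball (word_map \<phi> u x) ((deriv_norm J \<phi> u / C) * \<rho>) \<subseteq> word_map \<phi> u ` ball x \<rho>"
    proof (rule ball_subset_image_ball)
      show "deriv_norm J \<phi> u / C > 0" using C(1) deriv_norm_pos by simp
      show "inj_on (word_map \<phi> u) (ball x \<rho>)"
        using inj_word_map \<rho> J_subset_V by (meson inj_on_subset order_trans)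
      fix y assume "y \<in> ball x \<rho>"
      then have y: "y \<in> V" using \<rho> J_subset_V by blast
      obtain D where D: "(word_map \<phi> u has_derivative D) (at y)"
        "\<And>h. norm (D h) = deriv_norm_at \<phi> u y * norm h"
        using word_map_similarity[OF y] by blast
      have "deriv_norm J \<phi> u / C \<le> deriv_norm_at \<phi> u y"
        using C(1) C(2)[OF y, of u] by (simp add: field_simps)
      then show "\<exists>D. (word_map \<phi> u has_derivative D) (at y) \<and> (\<forall>h. deriv_norm J \<phi> u / C * norm h \<le> norm (D h))"
        using D by (intro exI[of _ D] conjI allI) (simp_all only: mult_right_mono norm_ge_zero)
    qed (rule \<rho>)
    also have "\<dots> \<subseteq> word_map \<phi> u ` J" using \<rho> by blast
    finally have sub: "ball (word_map \<phi> u x) ((\<rho> / C) * deriv_norm J \<phi> u) \<subseteq> word_map \<phi> u ` J"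
      by (simp add: ac_simps)
    have "ball (word_map \<phi> u x + \<omega>) ((\<rho> / C) * deriv_norm J \<phi> u) \<subseteq> Js u"
    proof
      fix y assume "y \<in> ball (word_map \<phi> u x + \<omega>) ((\<rho> / C) * deriv_norm J \<phi> u)"
      then have "y - \<omega> \<in> ball (word_map \<phi> u x) ((\<rho> / C) * deriv_norm J \<phi> u)"
        by (simp add: dist_norm algebra_simps)
      then obtain z where "z \<in> J" "y - \<omega> = word_map \<phi> u z" using sub by blast
      then show "y \<in> Js u" unfolding \<omega> by (intro image_eqI[of _ _ z]) (auto simp: algebra_simps)
    qed
    then show ?thesis by blast
  qed
  moreover have "\<rho> / C > 0" using \<rho> C by simp
  ultimately show ?thesis using that by blast
qed

lemma Js_append: "Js (u @ v) \<subseteq> Js u"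
proof (induction v rule: rev_induct)
  case (snoc i v)
  then show ?case using Js_nested[of "u @ v" i] by auto
qed simp

text \<open>Incomparable words part after a common prefix \<open>w\<close>. Nesting places their
  pieces in two siblings below \<open>w\<close>, to which the open set condition applies.\<close>

lemma interior_Js_disjoint:
  assumes "open_set_condition Js" "parallel u v"
  shows "interior (Js u) \<inter> interior (Js v) = {}"
proof -
  obtain w i u' j v' where w: "i \<noteq> j" "u = w @ i # u'" "v = w @ j # v'"
    using parallel_decomp[OF assms(2)] by blast
  have "Js u \<subseteq> Js (w @ [i])" "Js v \<subseteq> Js (w @ [j])"
    using Js_append[of "w @ [i]" u'] Js_append[of "w @ [j]" v'] w by auto
  then have "interior (Js u) \<subseteq> interior (Js (w @ [i]))" "interior (Js v) \<subseteq> interior (Js (w @ [j]))"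
    by (simp_all add: interior_mono)
  moreover have "interior (Js (w @ [i])) \<inter> interior (Js (w @ [j])) = {}"
    using assms(1) w(1) unfolding open_set_condition_def by blast
  ultimately show ?thesis by blast
qed

section \<open>Stopping words\<close>

text \<open>Every proper prefix has to exceed \<delta>, not only the longest one, so prefix-freeness
  can be read off directly.\<close>

definition stopping :: "real \<Rightarrow> 'i list set" where
  "stopping \<delta> = {u. deriv_norm J \<phi> u \<le> \<delta> \<and> (\<forall>k<length u. deriv_norm J \<phi> (take k u) > \<delta>)}"

text \<open>Uniform decay gives a length \<open>N\<close> at which every word has norm at most
  \<delta>, so each word stops by then. This yields finiteness as well as completeness.\<close>

lemma cut_set_stopping:
  assumes "\<delta> > 0"
  shows "cut_set (stopping \<delta>)"
proof -
  obtain C c where C: "C \<ge> 1" "0 < c" "c < 1" "\<And>u. deriv_norm J \<phi> u \<le> C * c ^ length u"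
    using deriv_norm_decay by blast
  obtain N where N: "c ^ N < \<delta> / C" using real_arch_pow_inv[of "\<delta> / C" c] assms C by auto
  have small: "deriv_norm J \<phi> u \<le> \<delta>" if "length u = N" for u
    using C(1) C(4)[of u] N that by (simp add: field_simps)
  have "stopping \<delta> \<subseteq> {u. length u \<le> N}"
  proof
    fix u assume u: "u \<in> stopping \<delta>"
    show "u \<in> {u. length u \<le> N}"
    proof (rule ccontr)
      assume "u \<notin> {u. length u \<le> N}"
      then show False using u small[of "take N u"] by (auto simp: stopping_def not_le)
    qed
  qed
  moreover have "finite {u :: 'i list. length u \<le> N}"
    using finite_lists_length_le[of "UNIV :: 'i set" N] by simp
  ultimately have "finite (stopping \<delta>)" by (rule finite_subset)
  moreover have "v = []" if "u \<in> stopping \<delta>" "u @ v \<in> stopping \<delta>" for u v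
  proof (rule ccontr)
    assume "v \<noteq> []"
    then have "length u < length (u @ v)" by simp
    then have "deriv_norm J \<phi> (take (length u) (u @ v)) > \<delta>"
      using that(2) unfolding stopping_def by blast
    then show False using that(1) by (simp add: stopping_def)
  qed
  moreover have "\<exists>v\<in>stopping \<delta>. \<exists>z. u = v @ z" if "length u \<ge> N" for u
  proof -
    define k where "k = (LEAST k. deriv_norm J \<phi> (take k u) \<le> \<delta>)"
    have ex: "deriv_norm J \<phi> (take N u) \<le> \<delta>" using small that by simp
    have k: "deriv_norm J \<phi> (take k u) \<le> \<delta>" "k \<le> N"
      unfolding k_def using ex by (rule LeastI, rule Least_le)
    have less: "deriv_norm J \<phi> (take j u) > \<delta>" if "j < k" for j
      using not_less_Least that unfolding k_def by (metis not_le)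
    have "take k u \<in> stopping \<delta>"
      using k less by (auto simp: stopping_def min_def)
    then show ?thesis by (metis append_take_drop_id)
  qed
  ultimately show ?thesis unfolding cut_set_def by blast
qed

text \<open>Removing the last letter leaves a word of norm above \<delta>, and a single letter
  reduces the norm at most by the factor a / C, with \<open>a\<close> the least norm of a letter. So
  stopping words have norm comparable to \<delta>.\<close>

lemma stopping_lower:
  obtains b where "0 < b" "b \<le> 1" "\<And>\<delta> u. 0 < \<delta> \<Longrightarrow> \<delta> < 1 \<Longrightarrow> u \<in> stopping \<delta> \<Longrightarrow> b * \<delta> \<le> deriv_norm J \<phi> u"
proof -
  obtain C where C: "C \<ge> 1" "\<And>u v. deriv_norm J \<phi> u * deriv_norm J \<phi> v \<le> C * deriv_norm J \<phi> (u @ v)"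
    using deriv_norm_append_ge by blast
  define a where "a = Min (range (\<lambda>i. deriv_norm J \<phi> [i]))"
  have a: "a > 0" "\<And>i. a \<le> deriv_norm J \<phi> [i]"
    using deriv_norm_pos by (auto simp: a_def)
  have low: "a / C * \<delta> \<le> deriv_norm J \<phi> u" if "0 < \<delta>" "\<delta> < 1" "u \<in> stopping \<delta>" for \<delta> u
  proof (cases u rule: rev_cases)
    \<comment> \<open>The empty word has norm 1 and cannot stop at a scale below 1.\<close>
    case Nil
    then show ?thesis using that deriv_norm_Nil by (auto simp: stopping_def)
  next
    case (snoc v i)
    have "deriv_norm J \<phi> (take (length v) u) > \<delta>"
      using that(3) snoc unfolding stopping_def by (metis (mono_tags, lifting) length_append_singleton lessI mem_Collect_eq)
    then have "\<delta> * a \<le> deriv_norm J \<phi> v * deriv_norm J \<phi> [i]"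
      using a that snoc by (intro mult_mono) (auto intro: less_imp_le)
    also have "\<dots> \<le> C * deriv_norm J \<phi> u" using C(2) snoc by simp
    finally show ?thesis using C(1) by (simp add: field_simps)
  qed
  have "min 1 (a / C) * \<delta> \<le> deriv_norm J \<phi> u" if "0 < \<delta>" "\<delta> < 1" "u \<in> stopping \<delta>" for \<delta> u
    using low[OF that] that(1) by (meson less_imp_le min.cobounded2 mult_right_mono order_trans)
  moreover have "0 < min 1 (a / C)" using a C by simp
  ultimately show ?thesis using that[of "min 1 (a / C)"] by simp
qed

lemma parallel_stopping:
  assumes "\<delta> > 0" "u \<in> stopping \<delta>" "v \<in> stopping \<delta>" "u \<noteq> v"
  shows "parallel u v"
  using cut_set_stopping[OF assms(1)] assms(2-) unfolding cut_set_def
  by (metis append_Nil2 parallelI prefix_def)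

text \<open>The pieces of distinct stopping words contain disjoint balls of radius s * \<delta>. The
  centre of such a ball is within (D + L) * \<delta> of a fixed point of \<open>A\<close>: one step
  inside \<open>A\<close>, one inside the piece. The scale cancels from the packing bound.\<close>

lemma card_stopping_meeting:
  assumes "open_set_condition Js" "D \<ge> 0"
  obtains N where "N \<ge> 0" "\<And>\<delta> A. 0 < \<delta> \<Longrightarrow> \<delta> < 1 \<Longrightarrow> (\<And>x y. x \<in> A \<Longrightarrow> y \<in> A \<Longrightarrow> dist x y \<le> D * \<delta>) \<Longrightarrow>
    real (card {u \<in> stopping \<delta>. A \<inter> Js u \<noteq> {}}) \<le> N"
proof -
  obtain L where L: "L > 0" "\<And>u x y. x \<in> Js u \<Longrightarrow> y \<in> Js u \<Longrightarrow> dist x y \<le> L * deriv_norm J \<phi> u"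
    using Js_dist_le by blast
  obtain b where b: "b > 0" "\<And>u. \<exists>z. ball z (b * deriv_norm J \<phi> u) \<subseteq> Js u"
    using Js_contains_ball by blast
  obtain z where z: "\<And>u. ball (z u) (b * deriv_norm J \<phi> u) \<subseteq> Js u" using b(2) by metis
  obtain b' where b': "0 < b'" "\<And>\<delta> u. 0 < \<delta> \<Longrightarrow> \<delta> < 1 \<Longrightarrow> u \<in> stopping \<delta> \<Longrightarrow> b' * \<delta> \<le> deriv_norm J \<phi> u"
    using stopping_lower by metis
  \<comment> \<open>\<open>b\<close> relates the inner radius of a piece to its derivative norm, and
    \<open>b'\<close> relates that norm to \<delta>.\<close>
  define s where "s = b * b'"
  have s: "s > 0" using b b' by (simp add: s_def)
  define N where "N = ((D + L + s) / s) ^ DIM(real^'d)"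
  have N0: "N \<ge> 0" using s L assms by (simp add: N_def)
  have "real (card {u \<in> stopping \<delta>. A \<inter> Js u \<noteq> {}}) \<le> N"
    if \<delta>: "0 < \<delta>" "\<delta> < 1" and A: "\<And>x y. x \<in> A \<Longrightarrow> y \<in> A \<Longrightarrow> dist x y \<le> D * \<delta>" for \<delta> A
  proof (cases "A = {}")
    case True
    then show ?thesis using N0 by simp
  next
    case False
    then obtain x where x: "x \<in> A" by blast
    have fin: "finite (stopping \<delta>)" using cut_set_stopping[OF \<delta>(1)] by (simp add: cut_set_def)
    have sub: "ball (z u) (s * \<delta>) \<subseteq> interior (Js u)" if "u \<in> stopping \<delta>" for u
    proof -
      have "s * \<delta> \<le> b * deriv_norm J \<phi> u"
        using b'(2)[OF \<delta> that] b(1) by (simp add: s_def mult.assoc)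
      then have "ball (z u) (s * \<delta>) \<subseteq> Js u" using z[of u] by (meson order_trans subset_ball)
      then show ?thesis by (simp add: interior_maximal)
    qed
    have "real (card {u \<in> stopping \<delta>. A \<inter> Js u \<noteq> {}}) \<le> ((((D + L) * \<delta>) + s * \<delta>) / (s * \<delta>)) ^ DIM(real^'d)"
    proof (rule card_disjoint_balls_le[where z = x and c = z])
      fix u assume u: "u \<in> {u \<in> stopping \<delta>. A \<inter> Js u \<noteq> {}}"
      then obtain y where y: "y \<in> A" "y \<in> Js u" by blast
      have "z u \<in> ball (z u) (s * \<delta>)" using s \<delta> by simp
      then have "z u \<in> Js u" using sub[of u] u interior_subset by blast
      then have "dist y (z u) \<le> L * deriv_norm J \<phi> u" using L(2) y by blast
      also have "\<dots> \<le> L * \<delta>" using u L(1) by (simp add: stopping_def)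
      finally show "dist x (z u) \<le> (D + L) * \<delta>"
        using A[OF x y(1)] dist_triangle[of x "z u" y] by (simp add: algebra_simps)
    next
      fix u v assume uv: "u \<in> {u \<in> stopping \<delta>. A \<inter> Js u \<noteq> {}}" "v \<in> {u \<in> stopping \<delta>. A \<inter> Js u \<noteq> {}}" "u \<noteq> v"
      then have "interior (Js u) \<inter> interior (Js v) = {}"
        by (intro interior_Js_disjoint assms parallel_stopping[OF \<delta>(1)]) auto
      then show "ball (z u) (s * \<delta>) \<inter> ball (z v) (s * \<delta>) = {}" using sub uv by blast
    qed (use fin s \<delta> L assms in auto)
    also have "((D + L) * \<delta> + s * \<delta>) / (s * \<delta>) = (D + L + s) / s"
      using \<delta> s by (simp add: field_simps)
    finally show ?thesis unfolding N_def .
  qed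
  then show ?thesis using that N0 by blast
qed

section \<open>The coding map\<close>

text \<open>\<open>the_elem\<close> is meaningful only for a singleton. The pieces along an infinite
  word are nonempty, closed and nested with diameters tending to 0, so their intersection is
  one.\<close>

lemma coding_mem: "coding Js u \<in> Js (prefix_word m u)"
proof -
  have step: "Js (prefix_word (Suc n) u) \<subseteq> Js (prefix_word n u)" for n
    using Js_nested[of "prefix_word n u" "u n"] by (simp add: prefix_word_def)
  have mono: "Js (prefix_word n u) \<subseteq> Js (prefix_word m u)" if "m \<le> n" for m n
    using that step by (rule lift_Suc_antimono_le[where f = "\<lambda>n. Js (prefix_word n u)", rotated])
  obtain L where L: "L > 0" "\<And>u x y. x \<in> Js u \<Longrightarrow> y \<in> Js u \<Longrightarrow> dist x y \<le> L * deriv_norm J \<phi> u"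
    using Js_dist_le by blast
  obtain C c where C: "C \<ge> 1" "0 < c" "c < 1" "\<And>u. deriv_norm J \<phi> u \<le> C * c ^ length u"
    using deriv_norm_decay by blast
  have "\<exists>a. \<Inter>(range (\<lambda>n. Js (prefix_word (Suc n) u))) = {a}"
  proof (rule decreasing_closed_nest_sing)
    fix e :: real assume "e > 0"
    then obtain n where n: "c ^ n < e / (L * C)" using real_arch_pow_inv[of "e / (L * C)" c] C L by auto
    have "dist x y < e" if "x \<in> Js (prefix_word (Suc n) u)" "y \<in> Js (prefix_word (Suc n) u)" for x y
    proof -
      have "x \<in> Js (prefix_word n u)" "y \<in> Js (prefix_word n u)" using that step by blast+
      then have "dist x y \<le> L * deriv_norm J \<phi> (prefix_word n u)" by (rule L(2))
      also have "\<dots> \<le> L * (C * c ^ n)"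
        using C(4)[of "prefix_word n u"] L(1) by (simp add: prefix_word_def)
      also have "\<dots> < e" using n L C by (simp add: field_simps)
      finally show ?thesis .
    qed
    then show "\<exists>n. \<forall>x\<in>Js (prefix_word (Suc n) u). \<forall>y\<in>Js (prefix_word (Suc n) u). dist x y < e" by blast
  qed (use Js_closed Js_nonempty mono in auto)
  then obtain a where a: "\<Inter>(range (\<lambda>n. Js (prefix_word (Suc n) u))) = {a}" by blast
  \<comment> \<open>The intersection in \<open>coding\<close> starts at prefixes of length 1, hence
    the shift by \<open>Suc\<close>.\<close>
  have "(\<Inter>m\<in>{1..}. Js (prefix_word m u)) = \<Inter>(range (\<lambda>n. Js (prefix_word (Suc n) u)))"
    by (auto simp: Suc_le_eq gr0_conv_Suc)
  then have "coding Js u = a" using a by (simp add: coding_def)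
  then have "coding Js u \<in> Js (prefix_word (Suc m) u)" using a by blast
  then show ?thesis using step by blast
qed

lemma coding_mem_cylinder: "u \<in> cylinder w \<Longrightarrow> coding Js u \<in> Js w"
  using coding_mem[of u "length w"] by (simp add: cylinder_def)

end

text \<open>Cylinders are open: a distance below 2 to the power -length w forces agreement on the
  first \<open>length w\<close> letters.\<close>

lemma cylinder_sets: "cylinder w \<in> sets word_borel"
proof -
  interpret Metric_space UNIV word_dist by (rule Metric_space_word_dist)
  have "openin mtopology (cylinder w)"
    unfolding openin_mtopology
  proof (intro conjI ballI allI impI)
    fix u assume u: "u \<in> cylinder w"
    have "mball u ((1/2) ^ length w) \<subseteq> cylinder w"
    proof
      fix v assume "v \<in> mball u ((1/2) ^ length w)"
      then have d: "word_dist u v < (1/2) ^ length w" by simp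
      have "u k = v k" if "k < length w" for k
      proof (rule ccontr)
        assume k: "u k \<noteq> v k"
        then have "(LEAST k. u k \<noteq> v k) \<le> k" by (rule Least_le)
        then have "(1/2::real) ^ length w \<le> (1/2) ^ (LEAST k. u k \<noteq> v k)"
          using that by (intro power_decreasing) auto
        then show False using d k by (auto simp: word_dist_def split: if_splits)
      qed
      then have "prefix_word (length w) v = prefix_word (length w) u"
        by (simp add: prefix_word_def)
      then show "v \<in> cylinder w" using u by (simp add: cylinder_def)
    qed
    then show "\<exists>r>0. mball u r \<subseteq> cylinder w" by (intro exI[of _ "(1/2) ^ length w"]) auto
  qed auto
  then show ?thesis by (simp add: word_borel_def)
qed

context acifs
begin

text \<open>An infinite word is coded into an open set exactly when the piece of some prefix lies
  inside that set. The preimage is thus a union of cylinders over finite words, of which there are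
  countably many.\<close>

lemma coding_measurable: "coding Js \<in> borel_measurable word_borel"
proof (rule borel_measurableI)
  fix S :: "(real^'d) set" assume S: "open S"
  obtain L where L: "L > 0" "\<And>u x y. x \<in> Js u \<Longrightarrow> y \<in> Js u \<Longrightarrow> dist x y \<le> L * deriv_norm J \<phi> u"
    using Js_dist_le by blast
  obtain C c where C: "C \<ge> 1" "0 < c" "c < 1" "\<And>u. deriv_norm J \<phi> u \<le> C * c ^ length u"
    using deriv_norm_decay by blast
  have "coding Js -` S = (\<Union>w\<in>{w. Js w \<subseteq> S}. cylinder w)"
  proof (intro equalityI subsetI)
    fix u assume "u \<in> coding Js -` S"
    then obtain e where e: "e > 0" "ball (coding Js u) e \<subseteq> S" using S open_contains_ball by blast
    then obtain n where n: "c ^ n < e / (L * C)" using real_arch_pow_inv[of "e / (L * C)" c] C L by auto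
    have "Js (prefix_word n u) \<subseteq> ball (coding Js u) e"
    proof
      fix y assume "y \<in> Js (prefix_word n u)"
      then have "dist (coding Js u) y \<le> L * deriv_norm J \<phi> (prefix_word n u)"
        using L(2) coding_mem by blast
      also have "\<dots> \<le> L * (C * c ^ n)"
        using C(4)[of "prefix_word n u"] L(1) by (simp add: prefix_word_def)
      also have "\<dots> < e" using n L C by (simp add: field_simps)
      finally show "y \<in> ball (coding Js u) e" by simp
    qed
    moreover have "u \<in> cylinder (prefix_word n u)" by (simp add: cylinder_def prefix_word_def)
    ultimately show "u \<in> (\<Union>w\<in>{w. Js w \<subseteq> S}. cylinder w)" using e by blast
  qed (use coding_mem_cylinder in auto)
  moreover have "(\<Union>w\<in>{w. Js w \<subseteq> S}. cylinder w) \<in> sets word_borel"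
    by (intro sets.countable_UN' countableI_type) (auto intro: cylinder_sets)
  ultimately show "coding Js -` S \<inter> space word_borel \<in> sets word_borel"
    by (simp add: word_borel_def space_measure_of_conv)
qed

end

lemma nonpos_if_multiples_bounded:
  fixes x :: real
  assumes "\<And>k. real k * x \<le> B"
  shows "x \<le> 0"
proof (rule ccontr)
  assume "\<not> x \<le> 0"
  then obtain k where "B < real k * x" using ex_less_of_nat_mult[of x B] by auto
  then show False using assms[of k] by simp
qed

section \<open>Pressure\<close>

locale bernoulli_acifs = acifs J V \<phi> Js
  for J V :: "(real^'d) set" and \<phi> :: "'i::finite \<Rightarrow> real^'d \<Rightarrow> real^'d" and Js :: "'i list \<Rightarrow> (real^'d) set" +
  fixes p :: "'i \<Rightarrow> real" and \<mu> :: "(nat \<Rightarrow> 'i) measure"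
  assumes p_pos: "\<And>i. p i > 0" and bernoulli: "bernoulli_measure p \<mu>"
begin

lemma prob_space_\<mu>: "prob_space \<mu>"
  and sets_\<mu>: "sets \<mu> = sets word_borel"
  and measure_cylinder: "measure \<mu> (cylinder u) = (\<Prod>i\<leftarrow>u. p i)"
  using bernoulli by (auto simp: bernoulli_measure_def)

sublocale prob_space \<mu> by (rule prob_space_\<mu>)

lemma measure_cylinder_pos: "measure \<mu> (cylinder u) > 0"
  unfolding measure_cylinder using p_pos by (induction u) auto

lemma measure_cylinder_append:
  "measure \<mu> (cylinder (u @ v)) = measure \<mu> (cylinder u) * measure \<mu> (cylinder v)"
  by (simp add: measure_cylinder)

definition weight :: "real \<Rightarrow> real \<Rightarrow> 'i list \<Rightarrow> real" where
  "weight q \<beta> u = deriv_norm J \<phi> u powr \<beta> * measure \<mu> (cylinder u) powr q"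

text \<open>The Bernoulli factor is exactly multiplicative, so the only error comes from the
  derivative norms. Their defect \<open>x\<close> lies between 1 / C and C and is raised to the
  power \<beta>.\<close>

lemma quasi_mult_weight_weight:
  obtains K where "quasi_mult_weight (weight q \<beta>) K"
proof -
  obtain C where C: "C \<ge> 1" "\<And>u v. deriv_norm J \<phi> u * deriv_norm J \<phi> v \<le> C * deriv_norm J \<phi> (u @ v)"
    using deriv_norm_append_ge by blast
  let ?K = "C powr \<bar>\<beta>\<bar>"
  have K1: "?K \<ge> 1" using C(1) by (simp add: ge_one_powr_ge_zero)
  have pos: "weight q \<beta> u > 0" for u
    unfolding weight_def using deriv_norm_pos[of u] measure_cylinder_pos[of u] by simp
  have "weight q \<beta> (u @ v) \<le> ?K * (weight q \<beta> u * weight q \<beta> v)"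
    "weight q \<beta> u * weight q \<beta> v \<le> ?K * weight q \<beta> (u @ v)" for u v
  proof -
    define x where "x = deriv_norm J \<phi> (u @ v) / (deriv_norm J \<phi> u * deriv_norm J \<phi> v)"
    have uv: "deriv_norm J \<phi> u > 0" "deriv_norm J \<phi> v > 0" by (rule deriv_norm_pos)+
    have "x \<le> 1"
      unfolding x_def using deriv_norm_append_le[of u v] uv by (simp add: pos_divide_le_eq)
    then have x1: "x \<le> C" using C(1) by simp
    have "inverse C \<le> x"
      using C(1) C(2)[of u v] uv unfolding x_def by (simp add: field_simps)
    note x = powr_abs_bounds[OF this x1 C(1), of \<beta>]
    have "x > 0" unfolding x_def using uv deriv_norm_pos[of "u @ v"] by simp
    moreover have "deriv_norm J \<phi> (u @ v) = x * (deriv_norm J \<phi> u * deriv_norm J \<phi> v)"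
      using uv by (simp add: x_def)
    ultimately have eq: "weight q \<beta> (u @ v) = x powr \<beta> * (weight q \<beta> u * weight q \<beta> v)"
      using uv measure_cylinder_pos[of u] measure_cylinder_pos[of v]
      by (simp add: weight_def measure_cylinder_append powr_mult)
    show "weight q \<beta> (u @ v) \<le> ?K * (weight q \<beta> u * weight q \<beta> v)"
      unfolding eq using x(2) pos[of u] pos[of v] by (intro mult_right_mono) auto
    have "1 \<le> ?K * x powr \<beta>"
      using mult_left_mono[OF x(1), of ?K] K1 C(1) by simp
    then have "1 * (weight q \<beta> u * weight q \<beta> v) \<le> ?K * x powr \<beta> * (weight q \<beta> u * weight q \<beta> v)"
      using pos[of u] pos[of v] by (intro mult_right_mono) auto
    then show "weight q \<beta> u * weight q \<beta> v \<le> ?K * weight q \<beta> (u @ v)"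
      by (simp add: eq mult.assoc)
  qed
  with pos K1 have "quasi_mult_weight (weight q \<beta>) ?K" by unfold_locales auto
  then show ?thesis using that by blast
qed

text \<open>The rate does not involve the constant \<open>K\<close> of the locale, so no choice of
  \<open>K\<close> for each \<beta> has to be made here.\<close>

definition growth :: "real \<Rightarrow> real \<Rightarrow> real" where
  "growth q \<beta> = quasi_mult_weight.rate (weight q \<beta>)"

abbreviation (input) level_sum :: "real \<Rightarrow> real \<Rightarrow> nat \<Rightarrow> real" where
  "level_sum q \<beta> k \<equiv> (\<Sum>u | length u = k. weight q \<beta> u)"

lemma level_sum_pos: "level_sum q \<beta> k > 0"
  and growth_tendsto: "(\<lambda>k. ln (level_sum q \<beta> k) / real k) \<longlonglongrightarrow> growth q \<beta>"
proof -
  obtain K where "quasi_mult_weight (weight q \<beta>) K" by (rule quasi_mult_weight_weight)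
  then interpret quasi_mult_weight "weight q \<beta>" K .
  show "level_sum q \<beta> k > 0" using total_pos[of k] by (simp add: total_def)
  show "(\<lambda>k. ln (level_sum q \<beta> k) / real k) \<longlonglongrightarrow> growth q \<beta>"
    using rate_tendsto by (simp add: total_def growth_def)
qed

lemma growth_bound:
  obtains M where "\<And>k. \<bar>ln (level_sum q \<beta> k) - real k * growth q \<beta>\<bar> \<le> M"
proof -
  obtain K where "quasi_mult_weight (weight q \<beta>) K" by (rule quasi_mult_weight_weight)
  then interpret quasi_mult_weight "weight q \<beta>" K .
  show ?thesis using that[of "ln K"] rate_bound by (simp add: total_def growth_def)
qed

section \<open>Dependence of the growth rate on the exponent\<close>

lemma deriv_norm_ge_power:
  obtains e where "0 < e" "\<And>u. e ^ length u \<le> deriv_norm J \<phi> u"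
proof -
  obtain C where C: "C \<ge> 1" "\<And>u v. deriv_norm J \<phi> u * deriv_norm J \<phi> v \<le> C * deriv_norm J \<phi> (u @ v)"
    using deriv_norm_append_ge by blast
  define a where "a = Min (range (\<lambda>i. deriv_norm J \<phi> [i]))"
  have a: "a > 0" "\<And>i. a \<le> deriv_norm J \<phi> [i]"
    using deriv_norm_pos by (auto simp: a_def)
  have "(a / C) ^ length u \<le> deriv_norm J \<phi> u" for u
  proof (induction u)
    case Nil
    show ?case by (simp add: deriv_norm_Nil)
  next
    case (Cons i u)
    have "(a / C) ^ length (i # u) \<le> (deriv_norm J \<phi> [i] / C) * deriv_norm J \<phi> u"
      using Cons a C(1) deriv_norm_pos[of "[i]"] by (simp, intro mult_mono divide_right_mono) auto
    also have "\<dots> \<le> deriv_norm J \<phi> (i # u)"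
      using C(2)[of "[i]" u] C(1) by (simp add: field_simps)
    finally show ?case .
  qed
  moreover have "a / C > 0" using a C by simp
  ultimately show ?thesis using that by blast
qed

text \<open>Raising \<beta> multiplies each weight by the derivative norm to the power of the
  increment. On level \<open>k\<close> that norm lies between the k-th power of \<open>e\<close> and
  \<open>C\<close> times that of \<open>c\<close>, so the slopes lie between ln e and ln c; the
  constant \<open>C\<close> is lost after division by \<open>k\<close>.\<close>

lemma growth_slope:
  obtains b c where "b \<le> c" "c < 0"
    "\<And>\<beta> \<beta>'. \<beta> \<le> \<beta>' \<Longrightarrow> growth q \<beta>' \<le> growth q \<beta> + (\<beta>' - \<beta>) * c"
    "\<And>\<beta> \<beta>'. \<beta> \<le> \<beta>' \<Longrightarrow> growth q \<beta> + (\<beta>' - \<beta>) * b \<le> growth q \<beta>'"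
proof -
  obtain C c where C: "C \<ge> 1" "0 < c" "c < 1" "\<And>u. deriv_norm J \<phi> u \<le> C * c ^ length u"
    using deriv_norm_decay by blast
  obtain e where e: "0 < e" "\<And>u. e ^ length u \<le> deriv_norm J \<phi> u"
    using deriv_norm_ge_power by blast
  have weight_split: "weight q \<beta>' u = deriv_norm J \<phi> u powr (\<beta>' - \<beta>) * weight q \<beta> u" for \<beta> \<beta>' u
    using deriv_norm_pos[of u] by (simp add: weight_def powr_diff)
  have weight_nonneg: "weight q \<beta> u \<ge> 0" for \<beta> u by (simp add: weight_def)
  have upper: "growth q \<beta>' \<le> growth q \<beta> + (\<beta>' - \<beta>) * ln c" if le: "\<beta> \<le> \<beta>'" for \<beta> \<beta>'
  proof -
    obtain M M' where M: "\<And>k. \<bar>ln (level_sum q \<beta> k) - real k * growth q \<beta>\<bar> \<le> M"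
      "\<And>k. \<bar>ln (level_sum q \<beta>' k) - real k * growth q \<beta>'\<bar> \<le> M'"
      by (metis growth_bound)
    have "real k * (growth q \<beta>' - growth q \<beta> - (\<beta>' - \<beta>) * ln c) \<le> (\<beta>' - \<beta>) * ln C + M + M'" for k
    proof -
      have "level_sum q \<beta>' k \<le> (\<Sum>u | length u = k. (C * c ^ k) powr (\<beta>' - \<beta>) * weight q \<beta> u)"
        unfolding weight_split[of \<beta>' _ \<beta>] using C(4) le deriv_norm_pos weight_nonneg
        by (intro sum_mono mult_right_mono powr_mono2) (auto intro: less_imp_le)
      also have "\<dots> = (C * c ^ k) powr (\<beta>' - \<beta>) * level_sum q \<beta> k"
        by (simp add: sum_distrib_left)
      finally have "ln (level_sum q \<beta>' k) \<le> ln ((C * c ^ k) powr (\<beta>' - \<beta>) * level_sum q \<beta> k)"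
        using level_sum_pos by (intro ln_mono) auto
      also have "\<dots> = (\<beta>' - \<beta>) * (ln C + real k * ln c) + ln (level_sum q \<beta> k)"
        using C level_sum_pos[of q \<beta> k] by (simp add: ln_mult ln_powr ln_realpow)
      finally show ?thesis using M(1)[of k] M(2)[of k] by (simp add: algebra_simps)
    qed
    then have "growth q \<beta>' - growth q \<beta> - (\<beta>' - \<beta>) * ln c \<le> 0" by (rule nonpos_if_multiples_bounded)
    then show ?thesis by simp
  qed
  have lower: "growth q \<beta> + (\<beta>' - \<beta>) * ln e \<le> growth q \<beta>'" if le: "\<beta> \<le> \<beta>'" for \<beta> \<beta>'
  proof -
    obtain M M' where M: "\<And>k. \<bar>ln (level_sum q \<beta> k) - real k * growth q \<beta>\<bar> \<le> M"
      "\<And>k. \<bar>ln (level_sum q \<beta>' k) - real k * growth q \<beta>'\<bar> \<le> M'"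
      by (metis growth_bound)
    have "real k * (growth q \<beta> + (\<beta>' - \<beta>) * ln e - growth q \<beta>') \<le> M + M'" for k
    proof -
      have "(e ^ k) powr (\<beta>' - \<beta>) * level_sum q \<beta> k = (\<Sum>u | length u = k. (e ^ k) powr (\<beta>' - \<beta>) * weight q \<beta> u)"
        by (simp add: sum_distrib_left)
      also have "\<dots> \<le> level_sum q \<beta>' k"
        unfolding weight_split[of \<beta>' _ \<beta>] using e le weight_nonneg
        by (intro sum_mono mult_right_mono powr_mono2) auto
      finally have "ln ((e ^ k) powr (\<beta>' - \<beta>) * level_sum q \<beta> k) \<le> ln (level_sum q \<beta>' k)"
        using level_sum_pos[of q \<beta> k] e(1) by (intro ln_mono) auto
      moreover have "ln ((e ^ k) powr (\<beta>' - \<beta>) * level_sum q \<beta> k) = (\<beta>' - \<beta>) * (real k * ln e) + ln (level_sum q \<beta> k)"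
        using e level_sum_pos[of q \<beta> k] by (simp add: ln_mult ln_powr ln_realpow)
      ultimately show ?thesis using M(1)[of k] M(2)[of k] by (simp add: algebra_simps)
    qed
    then have "growth q \<beta> + (\<beta>' - \<beta>) * ln e - growth q \<beta>' \<le> 0" by (rule nonpos_if_multiples_bounded)
    then show ?thesis by simp
  qed
  have "ln e \<le> ln c" using upper[of 0 1] lower[of 0 1] by simp
  moreover have "ln c < 0" using C by simp
  ultimately show ?thesis using that upper lower by blast
qed

text \<open>The slope bounds make the growth rate Lipschitz and strictly decreasing, with values of
  both signs; the zero comes from the intermediate value theorem.\<close>

lemma growth_zero:
  obtains \<beta>0 where "growth q \<beta>0 = 0" "\<And>\<beta>. growth q \<beta> < 0 \<longleftrightarrow> \<beta> > \<beta>0" "\<And>\<beta>. growth q \<beta> > 0 \<longleftrightarrow> \<beta> < \<beta>0"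
proof -
  obtain b c where bc: "b \<le> c" "c < 0"
    "\<And>\<beta> \<beta>'. \<beta> \<le> \<beta>' \<Longrightarrow> growth q \<beta>' \<le> growth q \<beta> + (\<beta>' - \<beta>) * c"
    "\<And>\<beta> \<beta>'. \<beta> \<le> \<beta>' \<Longrightarrow> growth q \<beta> + (\<beta>' - \<beta>) * b \<le> growth q \<beta>'"
    using growth_slope[of q] by blast
  have less: "growth q \<beta>' < growth q \<beta>" if "\<beta> < \<beta>'" for \<beta> \<beta>'
    using bc(3)[of \<beta> \<beta>'] mult_pos_neg[of "\<beta>' - \<beta>" c] bc(2) that by simp
  have diff: "\<bar>growth q \<beta>' - growth q \<beta>\<bar> \<le> - b * \<bar>\<beta>' - \<beta>\<bar>" if "\<beta> \<le> \<beta>'" for \<beta> \<beta>'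
    using bc(4)[OF that] less[of \<beta> \<beta>'] that by (cases "\<beta> = \<beta>'") (auto simp: algebra_simps)
  have "(- b)-lipschitz_on UNIV (growth q)"
  proof (rule lipschitz_onI)
    fix \<beta> \<beta>'
    show "dist (growth q \<beta>) (growth q \<beta>') \<le> - b * dist \<beta> \<beta>'"
      using diff[of \<beta> \<beta>'] diff[of \<beta>' \<beta>] by (cases "\<beta> \<le> \<beta>'") (auto simp: dist_real_def abs_minus_commute)
  qed (use bc in auto)
  then have cont: "continuous_on S (growth q)" for S
    using lipschitz_on_continuous_on continuous_on_subset by blast
  \<comment> \<open>Over a length \<open>r\<close> the guaranteed descent is exactly the absolute
    value of the growth at 0, so there is a sign change between -r and r.\<close>
  define r where "r = \<bar>growth q 0\<bar> / (- c)"
  have r: "r \<ge> 0" "r * c = - \<bar>growth q 0\<bar>" using bc(2) divide_nonneg_pos[of "\<bar>growth q 0\<bar>" "- c"] by (auto simp: r_def)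
  have "growth q r \<le> 0" using bc(3)[of 0 r] r by simp
  moreover have "growth q (- r) \<ge> 0" using bc(3)[of "- r" 0] r by simp
  ultimately obtain \<beta>0 where \<beta>0: "growth q \<beta>0 = 0"
    using IVT2'[of "growth q" r 0 "- r"] r cont by auto
  have "growth q \<beta> < 0 \<longleftrightarrow> \<beta> > \<beta>0" "growth q \<beta> > 0 \<longleftrightarrow> \<beta> < \<beta>0" for \<beta>
    using less[of \<beta> \<beta>0] less[of \<beta>0 \<beta>] \<beta>0 by (cases \<beta> \<beta>0 rule: linorder_cases; simp)+
  then show ?thesis using that \<beta>0 by blast
qed

text \<open>\<open>lim\<close> has the intended value only once convergence is known, which
  \<open>growth_tendsto\<close> supplies.\<close>

lemma pressure_eq: "pressure J \<phi> \<mu> t q = sgn (1 - q) * growth q (t * (1 - q))"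
proof -
  have "(\<lambda>k. sgn (1 - q) * (ln (level_sum q (t * (1 - q)) k) / real k)) \<longlonglongrightarrow> sgn (1 - q) * growth q (t * (1 - q))"
    by (intro tendsto_mult tendsto_const growth_tendsto)
  then show ?thesis unfolding pressure_def weight_def by (intro limI) simp
qed

text \<open>For q > 1 both the factor sgn (1 - q) and the division by 1 - q reverse the order. The
  reversals cancel, so in either case the pressure is negative precisely to the right of \<beta>0 /
  (1 - q).\<close>

lemma growth_pressure_dim:
  assumes "q \<noteq> 1"
  shows "growth q ((1 - q) * pressure_dim J \<phi> \<mu> q) = 0"
proof -
  obtain \<beta>0 where \<beta>0: "growth q \<beta>0 = 0" "\<And>\<beta>. growth q \<beta> < 0 \<longleftrightarrow> \<beta> > \<beta>0" "\<And>\<beta>. growth q \<beta> > 0 \<longleftrightarrow> \<beta> < \<beta>0"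
    using growth_zero by blast
  have "pressure J \<phi> \<mu> t q < 0 \<longleftrightarrow> t > \<beta>0 / (1 - q)" for t
  proof (cases "q < 1")
    case True
    then show ?thesis using \<beta>0(2)[of "t * (1 - q)"] by (simp add: pressure_eq pos_divide_less_eq)
  next
    case False
    then have "q > 1" using assms by simp
    then show ?thesis using \<beta>0(3)[of "t * (1 - q)"] by (simp add: pressure_eq neg_divide_less_eq)
  qed
  then have "{t. pressure J \<phi> \<mu> t q < 0} = {\<beta>0 / (1 - q)<..}" by auto
  then have "pressure_dim J \<phi> \<mu> q = \<beta>0 / (1 - q)" by (simp add: pressure_dim_def)
  then show ?thesis using assms \<beta>0(1) by simp
qed

text \<open>On stopping words the derivative factor of the weight is \<delta> to the power \<beta>
  up to \<open>E\<close>. Pulling it out of the bounded code sum leaves the sum of the powers of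
  \<mu>, of order \<delta> to the power -\<beta>.\<close>

lemma stopping_sum_bounds:
  assumes "q \<noteq> 1"
  obtains A B where "A > 0" "B > 0" "\<And>\<delta>. 0 < \<delta> \<Longrightarrow> \<delta> < 1 \<Longrightarrow>
    A * \<delta> powr ((q - 1) * pressure_dim J \<phi> \<mu> q) \<le> (\<Sum>u\<in>stopping \<delta>. measure \<mu> (cylinder u) powr q) \<and>
    (\<Sum>u\<in>stopping \<delta>. measure \<mu> (cylinder u) powr q) \<le> B * \<delta> powr ((q - 1) * pressure_dim J \<phi> \<mu> q)"
proof -
  define \<beta> where "\<beta> = (1 - q) * pressure_dim J \<phi> \<mu> q"
  obtain K where K: "quasi_mult_weight (weight q \<beta>) K" by (rule quasi_mult_weight_weight)
  interpret quasi_mult_weight "weight q \<beta>" K by (rule K)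
  obtain b where b: "0 < b" "b \<le> 1" "\<And>\<delta> u. 0 < \<delta> \<Longrightarrow> \<delta> < 1 \<Longrightarrow> u \<in> stopping \<delta> \<Longrightarrow> b * \<delta> \<le> deriv_norm J \<phi> u"
    using stopping_lower by blast
  have rate: "rate = 0" using growth_pressure_dim[OF assms] by (simp add: growth_def \<beta>_def)
  \<comment> \<open>The ratio of derivative norm to \<delta> lies between \<open>b\<close> and 1,
    hence between \<open>b\<close> and 1 / b, and \<open>powr_abs_bounds\<close> applies with C = 1
    / b.\<close>
  define E where "E = inverse b powr \<bar>\<beta>\<bar>"
  have E: "E > 0" using b by (simp add: E_def)
  have K0: "K > 0" using K_ge_1 by simp
  have bounds: "inverse (K ^ 3) * inverse E * \<delta> powr (- \<beta>) \<le> (\<Sum>u\<in>stopping \<delta>. measure \<mu> (cylinder u) powr q) \<and>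
    (\<Sum>u\<in>stopping \<delta>. measure \<mu> (cylinder u) powr q) \<le> K ^ 3 * E * \<delta> powr (- \<beta>)" if \<delta>: "0 < \<delta>" "\<delta> < 1" for \<delta>
  proof -
    let ?P = "\<Sum>u\<in>stopping \<delta>. measure \<mu> (cylinder u) powr q"
    let ?W = "\<Sum>u\<in>stopping \<delta>. weight q \<beta> u"
    have ratio: "inverse E * \<delta> powr \<beta> \<le> deriv_norm J \<phi> u powr \<beta>" "deriv_norm J \<phi> u powr \<beta> \<le> E * \<delta> powr \<beta>"
      if u: "u \<in> stopping \<delta>" for u
    proof -
      let ?x = "deriv_norm J \<phi> u / \<delta>"
      have "inverse (inverse b) \<le> ?x" using b(3)[OF \<delta> u] \<delta> by (simp add: pos_le_divide_eq)
      moreover have "?x \<le> 1" using u \<delta> by (simp add: stopping_def)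
      then have "?x \<le> inverse b" using b by (meson one_le_inverse order_trans)
      ultimately have x: "inverse E \<le> ?x powr \<beta>" "?x powr \<beta> \<le> E"
        unfolding E_def using b by (auto intro!: powr_abs_bounds one_le_inverse)
      have "deriv_norm J \<phi> u powr \<beta> = ?x powr \<beta> * \<delta> powr \<beta>"
        using \<delta> deriv_norm_pos[of u] by (simp add: powr_divide)
      then show "inverse E * \<delta> powr \<beta> \<le> deriv_norm J \<phi> u powr \<beta>" "deriv_norm J \<phi> u powr \<beta> \<le> E * \<delta> powr \<beta>"
        using x by (simp_all add: mult_right_mono)
    qed
    have W: "inverse (K ^ 3) \<le> ?W" "?W \<le> K ^ 3"
      by (rule cut_set_bounds[OF rate cut_set_stopping[OF \<delta>(1)]])+
    have "?W \<le> (\<Sum>u\<in>stopping \<delta>. E * \<delta> powr \<beta> * measure \<mu> (cylinder u) powr q)"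
      unfolding weight_def by (intro sum_mono mult_right_mono ratio) auto
    also have "\<dots> = E * \<delta> powr \<beta> * ?P" by (simp add: sum_distrib_left)
    finally have 1: "inverse (K ^ 3) \<le> E * \<delta> powr \<beta> * ?P" using W by simp
    have "inverse E * \<delta> powr \<beta> * ?P = (\<Sum>u\<in>stopping \<delta>. inverse E * \<delta> powr \<beta> * measure \<mu> (cylinder u) powr q)"
      by (simp add: sum_distrib_left)
    also have "\<dots> \<le> ?W"
      unfolding weight_def by (intro sum_mono mult_right_mono ratio) auto
    finally have 2: "inverse E * \<delta> powr \<beta> * ?P \<le> K ^ 3" using W by simp
    have d: "\<delta> powr \<beta> > 0" using \<delta> by simp
    have "inverse (K ^ 3) * inverse E * \<delta> powr (- \<beta>) \<le> ?P"
      using 1 E d K0 by (simp add: powr_minus field_simps)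
    moreover have "?P \<le> K ^ 3 * E * \<delta> powr (- \<beta>)"
      using 2 E d K0 by (simp add: powr_minus field_simps)
    ultimately show ?thesis by simp
  qed
  have eq: "- \<beta> = (q - 1) * pressure_dim J \<phi> \<mu> q" by (simp add: \<beta>_def algebra_simps)
  show ?thesis
  proof (rule that[of "inverse (K ^ 3) * inverse E" "K ^ 3 * E"])
    fix \<delta> :: real assume "0 < \<delta>" "\<delta> < 1"
    then show "inverse (K ^ 3) * inverse E * \<delta> powr ((q - 1) * pressure_dim J \<phi> \<mu> q) \<le> (\<Sum>u\<in>stopping \<delta>. measure \<mu> (cylinder u) powr q) \<and>
      (\<Sum>u\<in>stopping \<delta>. measure \<mu> (cylinder u) powr q) \<le> K ^ 3 * E * \<delta> powr ((q - 1) * pressure_dim J \<phi> \<mu> q)"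
      using bounds unfolding eq by blast
  qed (use E K0 in auto)
qed

section \<open>The image measure\<close>

lemma space_\<mu>: "space \<mu> = UNIV"
  using sets_eq_imp_space_eq[OF sets_\<mu>] by (simp add: word_borel_def space_measure_of_conv)

lemma measure_image:
  assumes "B \<in> sets borel"
  shows "measure (image_measure Js \<mu>) B = measure \<mu> (coding Js -` B)"
  using coding_measurable assms unfolding image_measure_def
  by (subst measure_distr) (simp_all add: space_\<mu> measurable_cong_sets[OF sets_\<mu> refl])

lemma coding_vimage_sets: "B \<in> sets borel \<Longrightarrow> coding Js -` B \<in> sets \<mu>"
  using measurable_sets[of "coding Js" \<mu> borel B] coding_measurable
  by (simp add: space_\<mu> measurable_cong_sets[OF sets_\<mu> refl])

lemma cylinder_sets_\<mu>: "cylinder u \<in> sets \<mu>"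
  by (simp add: sets_\<mu> cylinder_sets)

text \<open>Every infinite word has a prefix in the stopping set. If its code lies in
  \<open>B\<close>, the piece of that prefix contains this code and so meets
  \<open>B\<close>.\<close>

lemma measure_image_le:
  assumes "\<delta> > 0" "B \<in> sets borel"
  shows "measure (image_measure Js \<mu>) B \<le> (\<Sum>u | u \<in> stopping \<delta> \<and> B \<inter> Js u \<noteq> {}. measure \<mu> (cylinder u))"
proof -
  have cut: "cut_set (stopping \<delta>)" by (rule cut_set_stopping[OF assms(1)])
  then obtain N where N: "\<And>u. length u \<ge> N \<Longrightarrow> \<exists>v\<in>stopping \<delta>. \<exists>z. u = v @ z" and fin: "finite (stopping \<delta>)"
    unfolding cut_set_def by auto
  let ?S = "{u. u \<in> stopping \<delta> \<and> B \<inter> Js u \<noteq> {}}"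
  have finS: "finite ?S" using fin by simp
  have "coding Js -` B \<subseteq> (\<Union>u\<in>?S. cylinder u)"
  proof
    fix \<omega> assume \<omega>: "\<omega> \<in> coding Js -` B"
    obtain v z where v: "v \<in> stopping \<delta>" "prefix_word N \<omega> = v @ z"
      using N[of "prefix_word N \<omega>"] by (auto simp: prefix_word_def)
    have len: "length v \<le> N" using arg_cong[OF v(2), of length] by (simp add: prefix_word_def)
    have "v = take (length v) (prefix_word N \<omega>)" by (simp add: v(2))
    also have "\<dots> = prefix_word (length v) \<omega>" using len by (simp add: prefix_word_def take_map)
    finally have "\<omega> \<in> cylinder v" by (simp add: cylinder_def)
    moreover from this have "B \<inter> Js v \<noteq> {}" using coding_mem_cylinder \<omega> by blast
    ultimately show "\<omega> \<in> (\<Union>u\<in>?S. cylinder u)" using v by blast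
  qed
  then have "measure \<mu> (coding Js -` B) \<le> measure \<mu> (\<Union>u\<in>?S. cylinder u)"
    using finS cylinder_sets_\<mu> by (intro finite_measure_mono) auto
  also have "\<dots> \<le> (\<Sum>u\<in>?S. measure \<mu> (cylinder u))"
    using finS cylinder_sets_\<mu> by (intro finite_measure_subadditive_finite) auto
  finally show ?thesis by (simp add: measure_image[OF assms(2)])
qed

lemma measure_cylinder_le:
  assumes "finite F" "F \<subseteq> sets borel" "Js u \<subseteq> \<Union>F"
  shows "measure \<mu> (cylinder u) \<le> (\<Sum>Q\<in>F. measure (image_measure Js \<mu>) Q)"
proof -
  have "cylinder u \<subseteq> (\<Union>Q\<in>F. coding Js -` Q)"
  proof
    fix \<omega> assume "\<omega> \<in> cylinder u"
    then have "coding Js \<omega> \<in> \<Union>F" using coding_mem_cylinder assms(3) by blast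
    then show "\<omega> \<in> (\<Union>Q\<in>F. coding Js -` Q)" by simp
  qed
  then have "measure \<mu> (cylinder u) \<le> measure \<mu> (\<Union>Q\<in>F. coding Js -` Q)"
    using assms coding_vimage_sets by (intro finite_measure_mono sets.finite_UN) auto
  also have "\<dots> \<le> (\<Sum>Q\<in>F. measure \<mu> (coding Js -` Q))"
    using assms coding_vimage_sets by (intro finite_measure_subadditive_finite) auto
  also have "\<dots> = (\<Sum>Q\<in>F. measure (image_measure Js \<mu>) Q)"
    using assms by (intro sum.cong) (auto simp: measure_image)
  finally show ?thesis .
qed

text \<open>Codes lie in \<open>J\<close>, so cubes missing \<open>J\<close> have measure 0 and drop
  out. What remains is a finite sum of reals.\<close>

lemma moment_sum_eq:
  assumes "q > 0" "finite {Q \<in> mesh_cubes \<delta>. Q \<inter> J \<noteq> {}}"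
  shows "moment_sum q (image_measure Js \<mu>) \<delta> =
    ennreal (\<Sum>Q | Q \<in> mesh_cubes \<delta> \<and> Q \<inter> J \<noteq> {}. measure (image_measure Js \<mu>) Q powr q)"
proof -
  let ?F = "{Q \<in> mesh_cubes \<delta>. Q \<inter> J \<noteq> {}}"
  have zero: "measure (image_measure Js \<mu>) Q = 0" if "Q \<in> mesh_cubes \<delta> - ?F" for Q
  proof -
    have "coding Js -` Q = {}" using coding_mem Js_subset that by blast
    then show ?thesis using that mesh_cubes_borel[of Q \<delta>] by (simp add: measure_image)
  qed
  have "moment_sum q (image_measure Js \<mu>) \<delta> = (\<Sum>\<^sub>\<infinity>Q\<in>?F. ennreal (measure (image_measure Js \<mu>) Q powr q))"
    unfolding moment_sum_def using zero assms(1) by (intro infsum_cong_neutral) auto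
  also have "\<dots> = (\<Sum>Q\<in>?F. ennreal (measure (image_measure Js \<mu>) Q powr q))"
    using assms(2) by (rule infsum_finite)
  finally show ?thesis by (simp add: sum_ennreal)
qed

text \<open>Double counting is applied twice to the relation that a cube meets a piece: cubes are
  bounded by the cylinders of the pieces they meet, and cylinders by the cubes covering their
  piece.\<close>

lemma moment_sum_comparison:
  assumes "open_set_condition Js" "q > 0"
  obtains A B where "A > 0" "B > 0" "\<And>\<delta>. 0 < \<delta> \<Longrightarrow> \<delta> < 1 \<Longrightarrow>
    \<exists>m. moment_sum q (image_measure Js \<mu>) \<delta> = ennreal m \<and>
      A * (\<Sum>u\<in>stopping \<delta>. measure \<mu> (cylinder u) powr q) \<le> m \<and>
      m \<le> B * (\<Sum>u\<in>stopping \<delta>. measure \<mu> (cylinder u) powr q)"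
proof -
  let ?\<nu> = "image_measure Js \<mu>"
  obtain L where L: "L > 0" "\<And>u x y. x \<in> Js u \<Longrightarrow> y \<in> Js u \<Longrightarrow> dist x y \<le> L * deriv_norm J \<phi> u"
    using Js_dist_le by blast
  obtain N where N: "N \<ge> 0" "\<And>\<delta> A. 0 < \<delta> \<Longrightarrow> \<delta> < 1 \<Longrightarrow> (\<And>x y. x \<in> A \<Longrightarrow> y \<in> A \<Longrightarrow> dist x y \<le> real CARD('d) * \<delta>) \<Longrightarrow>
    real (card {u \<in> stopping \<delta>. A \<inter> Js u \<noteq> {}}) \<le> N"
    using card_stopping_meeting[OF assms(1), of "real CARD('d)"] by auto
  obtain M where M: "M \<ge> 0" "\<And>\<delta> (A :: (real^'d) set). \<delta> > 0 \<Longrightarrow> (\<And>x y. x \<in> A \<Longrightarrow> y \<in> A \<Longrightarrow> dist x y \<le> L * \<delta>) \<Longrightarrow>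
    finite {Q \<in> mesh_cubes \<delta>. Q \<inter> A \<noteq> {}} \<and> real (card {Q \<in> mesh_cubes \<delta>. Q \<inter> A \<noteq> {}}) \<le> M"
    using card_mesh_cubes_meeting by blast
  \<comment> \<open>Adding 1 keeps both constants positive even if \<open>M\<close> or
    \<open>N\<close> is 0.\<close>
  define A where "A = inverse ((M + 1) powr q * (N + 1))"
  define B where "B = (N + 1) powr q * (M + 1)"
  have "\<exists>m. moment_sum q ?\<nu> \<delta> = ennreal m \<and>
      A * (\<Sum>u\<in>stopping \<delta>. measure \<mu> (cylinder u) powr q) \<le> m \<and>
      m \<le> B * (\<Sum>u\<in>stopping \<delta>. measure \<mu> (cylinder u) powr q)" if \<delta>: "0 < \<delta>" "\<delta> < 1" for \<delta>
  proof -
    let ?S = "stopping \<delta>" and ?F = "{Q \<in> mesh_cubes \<delta>. Q \<inter> J \<noteq> {}}"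
    let ?P = "\<Sum>u\<in>?S. measure \<mu> (cylinder u) powr q"
    let ?m = "\<Sum>Q\<in>?F. measure ?\<nu> Q powr q"
    have finS: "finite ?S" using cut_set_stopping[OF \<delta>(1)] by (simp add: cut_set_def)
    have finF: "finite ?F"
    proof -
      \<comment> \<open>At fixed \<delta> the whole of \<open>J\<close> is a set of diameter
        \<open>diameter J / \<delta>\<close> times \<delta>. The resulting count depends on
        \<delta>, but only its finiteness is used.\<close>
      have dist: "dist x y \<le> diameter J / \<delta> * \<delta>" if "x \<in> J" "y \<in> J" for x y
        using diameter_bounded_bound[OF compact_imp_bounded[OF J_compact] that] \<delta> by simp
      obtain M' where M': "\<And>\<eta> (A :: (real^'d) set). \<eta> > 0 \<Longrightarrow>
          (\<And>x y. x \<in> A \<Longrightarrow> y \<in> A \<Longrightarrow> dist x y \<le> diameter J / \<delta> * \<eta>) \<Longrightarrow>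
          finite {Q \<in> mesh_cubes \<eta>. Q \<inter> A \<noteq> {}} \<and> real (card {Q \<in> mesh_cubes \<eta>. Q \<inter> A \<noteq> {}}) \<le> M'"
        using card_mesh_cubes_meeting by blast
      show ?thesis using M'[OF \<delta>(1) dist] by blast
    qed
    have FJs: "{Q \<in> ?F. Q \<inter> Js u \<noteq> {}} = {Q \<in> mesh_cubes \<delta>. Q \<inter> Js u \<noteq> {}}" for u
      using Js_subset by blast
    have cardF: "finite {Q \<in> mesh_cubes \<delta>. Q \<inter> Js u \<noteq> {}}" "real (card {Q \<in> mesh_cubes \<delta>. Q \<inter> Js u \<noteq> {}}) \<le> M + 1"
      if "u \<in> ?S" for u
    proof -
      have "dist x y \<le> L * \<delta>" if "x \<in> Js u" "y \<in> Js u" for x y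
      proof -
        have "dist x y \<le> L * deriv_norm J \<phi> u" by (rule L(2)[OF that])
        also have "\<dots> \<le> L * \<delta>" using \<open>u \<in> ?S\<close> L(1) by (simp add: stopping_def)
        finally show ?thesis .
      qed
      then show "finite {Q \<in> mesh_cubes \<delta>. Q \<inter> Js u \<noteq> {}}" "real (card {Q \<in> mesh_cubes \<delta>. Q \<inter> Js u \<noteq> {}}) \<le> M + 1"
        using M(2)[OF \<delta>(1), of "Js u"] by force+
    qed
    have cardS: "real (card {u \<in> ?S. Q \<inter> Js u \<noteq> {}}) \<le> N + 1" if "Q \<in> ?F" for Q
    proof -
      have "real (card {u \<in> ?S. Q \<inter> Js u \<noteq> {}}) \<le> N"
        by (rule N(2)[OF \<delta>]) (use mesh_cubes_dist_le that in blast)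
      then show ?thesis by simp
    qed
    have "?m \<le> (N + 1) powr q * (M + 1) * ?P"
    proof (rule sum_powr_double_counting[where r = "\<lambda>u Q. Q \<inter> Js u \<noteq> {}"])
      show "measure ?\<nu> Q \<le> (\<Sum>u | u \<in> ?S \<and> Q \<inter> Js u \<noteq> {}. measure \<mu> (cylinder u))" if "Q \<in> ?F" for Q
        using that mesh_cubes_borel by (intro measure_image_le \<delta>(1)) auto
      show "real (card {Q \<in> ?F. Q \<inter> Js u \<noteq> {}}) \<le> M + 1" if "u \<in> ?S" for u
        unfolding FJs by (rule cardF[OF that])
    qed (use finS finF assms N(1) M(1) cardS in auto)
    moreover have "?P \<le> (M + 1) powr q * (N + 1) * ?m"
    proof (rule sum_powr_double_counting[where r = "\<lambda>Q u. Q \<inter> Js u \<noteq> {}"])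
      show "measure \<mu> (cylinder u) \<le> (\<Sum>Q | Q \<in> ?F \<and> Q \<inter> Js u \<noteq> {}. measure ?\<nu> Q)" if "u \<in> ?S" for u
      proof (rule measure_cylinder_le)
        show "Js u \<subseteq> \<Union> {Q. Q \<in> ?F \<and> Q \<inter> Js u \<noteq> {}}"
        proof
          fix x assume x: "x \<in> Js u"
          obtain Q where "Q \<in> mesh_cubes \<delta>" "x \<in> Q" using mesh_cubes_cover[OF \<delta>(1)] by blast
          then show "x \<in> \<Union> {Q. Q \<in> ?F \<and> Q \<inter> Js u \<noteq> {}}" using x Js_subset by blast
        qed
        show "finite {Q. Q \<in> ?F \<and> Q \<inter> Js u \<noteq> {}}"
          using finF by (rule rev_finite_subset) blast
        show "{Q. Q \<in> ?F \<and> Q \<inter> Js u \<noteq> {}} \<subseteq> sets borel"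
          using mesh_cubes_borel by blast
      qed
      show "real (card {Q \<in> ?F. Q \<inter> Js u \<noteq> {}}) \<le> M + 1" if "u \<in> ?S" for u
        unfolding FJs by (rule cardF[OF that])
    qed (use finS finF assms N(1) M(1) cardS in auto)
    moreover have "(M + 1) powr q * (N + 1) > 0" using M(1) N(1) by (simp add: add_nonneg_pos)
    ultimately have "A * ?P \<le> ?m" "?m \<le> B * ?P"
      by (simp_all add: A_def B_def field_simps)
    then show ?thesis using moment_sum_eq[OF assms(2) finF] by blast
  qed
  moreover have "A > 0" "B > 0" using M(1) N(1) by (simp_all add: A_def B_def)
  ultimately show ?thesis using that by blast
qed

lemma has_gen_dim_pressure_dim:
  assumes "open_set_condition Js" "q > 0" "q \<noteq> 1"
  shows "has_gen_dim q (image_measure Js \<mu>) (ereal (pressure_dim J \<phi> \<mu> q))"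
proof -
  obtain A B where AB: "A > 0" "B > 0" "\<And>\<delta>. 0 < \<delta> \<Longrightarrow> \<delta> < 1 \<Longrightarrow>
    \<exists>m. moment_sum q (image_measure Js \<mu>) \<delta> = ennreal m \<and>
      A * (\<Sum>u\<in>stopping \<delta>. measure \<mu> (cylinder u) powr q) \<le> m \<and>
      m \<le> B * (\<Sum>u\<in>stopping \<delta>. measure \<mu> (cylinder u) powr q)"
    using moment_sum_comparison[OF assms(1,2)] by blast
  obtain A' B' where AB': "A' > 0" "B' > 0" "\<And>\<delta>. 0 < \<delta> \<Longrightarrow> \<delta> < 1 \<Longrightarrow>
    A' * \<delta> powr ((q - 1) * pressure_dim J \<phi> \<mu> q) \<le> (\<Sum>u\<in>stopping \<delta>. measure \<mu> (cylinder u) powr q) \<and>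
    (\<Sum>u\<in>stopping \<delta>. measure \<mu> (cylinder u) powr q) \<le> B' * \<delta> powr ((q - 1) * pressure_dim J \<phi> \<mu> q)"
    using stopping_sum_bounds[OF assms(3)] by blast
  show ?thesis
  proof (rule has_gen_dimI[of "A * A'" "B * B'"])
    fix \<delta> :: real assume \<delta>: "0 < \<delta>" "\<delta> < 1"
    let ?P = "\<Sum>u\<in>stopping \<delta>. measure \<mu> (cylinder u) powr q"
    let ?d = "\<delta> powr ((q - 1) * pressure_dim J \<phi> \<mu> q)"
    obtain m where m: "moment_sum q (image_measure Js \<mu>) \<delta> = ennreal m" "A * ?P \<le> m" "m \<le> B * ?P"
      using AB(3)[OF \<delta>] by blast
    have "A * A' * ?d \<le> A * ?P" "B * ?P \<le> B * B' * ?d"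
      using AB'(3)[OF \<delta>] AB(1,2) by (simp_all add: mult.assoc)
    then show "\<exists>m. moment_sum q (image_measure Js \<mu>) \<delta> = ennreal m \<and> A * A' * ?d \<le> m \<and> m \<le> B * B' * ?d"
      using m by (intro exI[of _ m]) auto
  qed (use AB AB' assms(3) in auto)
qed

end

theorem corollary1p5:
  fixes J V :: "(real^'d) set"
    and \<phi> :: "'i::finite \<Rightarrow> real^'d \<Rightarrow> real^'d"
    and Js :: "'i list \<Rightarrow> (real^'d) set"
    and p :: "'i \<Rightarrow> real"
    and \<mu> :: "(nat \<Rightarrow> 'i) measure"
  assumes "acifs J V \<phi> Js"
    and "open_set_condition Js"
    and "\<forall>i. p i > 0"
    and "(\<Sum>i\<in>UNIV. p i) = 1"
    and "bernoulli_measure p \<mu>"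
    and "bounded_overlap Js \<mu>"
  shows "\<forall>q::real. q > 0 \<longrightarrow> q \<noteq> 1 \<longrightarrow>
           has_gen_dim q (image_measure Js \<mu>) (ereal (pressure_dim J \<phi> \<mu> q))"
proof -
  interpret acifs J V \<phi> Js by (rule assms(1))
  interpret bernoulli_acifs J V \<phi> Js p \<mu>
    by unfold_locales (use assms in auto)
  show ?thesis using has_gen_dim_pressure_dim assms(2) by blast
qed

end
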